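(* Let $\mathcal{Q}$ be a set of laws on $\mathcal{X}^{\mathbb{N}}$ that is locally dominated by a reference measure $\mathtt{R}$ and fork-convex. Let $(E_t)_{t\ge0}$ be a $\mathcal{Q}$-safe e-process. Then the process $$L_t:=\operatorname*{ess\,sup}_{\mathtt{Q}\in\mathcal{Q},\ \tau\ge t}\mathbb{E}_{\mathtt{Q}}[E_\tau\mid\mathcal{F}_t],\qquad t\in\{0,1,2,\dots\},$$ where $\tau$ ranges over all finite stopping times (with $\tau\ge t$), is the smallest $\mathcal{Q}$-NSM that dominates $(E_t)$, and satisfies $L_0\le1$. (It is called the $\mathcal{Q}$-Snell envelope of $(E_t)$.) In particular, $(L_t)$ is a $\mathcal{Q}$-safe e-process.
   Context: $\mathcal{X}$ is a measurable space; $(X_t)_{t\ge1}$ are the coordinates on $\mathcal{X}^{\mathbb{N}}$, $\mathcal{F}_0$ is trivial, $\mathcal{F}_t=\sigma(X_1,\dots,X_t)$. In this statement a $\mathcal{Q}$-NSM is a nonnegative process $(M_t)_{t\ge0}$ adapted to $(\mathcal{F}_t)$ that is a supermartingale under every $\mathtt{Q}\in\mathcal{Q}$ (no normalization of $M_0$ beyond what is stated). Process $(L_t)$ dominates $(E_t)$ if $L_t\ge E_t$ for all $t$; "smallest" means that any $\mathcal{Q}$-NSM $(L'_t)$ dominating $(E_t)$ satisfies $L'_t\ge L_t$ for all $t$. Such inequalities are understood $\mathtt{Q}$-almost surely for every $\mathtt{Q}\in\mathcal{Q}$. A $\mathcal{Q}$-safe e-process is a nonnegative adapted process $(E_t)_{t\ge0}$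 with $\sup_{\mathtt{Q}\in\mathcal{Q}}\sup_\tau\mathbb{E}_{\mathtt{Q}}[E_\tau]\le1$, where $\tau$ ranges over all, possibly infinite, stopping times and $E_\infty:=\limsup_{t\to\infty}E_t$. A law $\mathtt{P}$ is locally dominated by a probability measure $\mathtt{R}$ if $\mathtt{P}|_{\mathcal{F}_t}\ll\mathtt{R}|_{\mathcal{F}_t}$ for all $t\in\mathbb{N}$; its likelihood ratio process is $Z_t=\mathrm{d}\mathtt{P}|_{\mathcal{F}_t}/\mathrm{d}\mathtt{R}|_{\mathcal{F}_t}$. Conditional expectations under locally dominated $\mathtt{Q}$ with likelihood ratio process $(Z_t)$ are always taken in the version, unique up to $\mathtt{R}$-nullsets, $\mathbb{E}_{\mathtt{Q}}[Y\mid\mathcal{F}_t]=\mathbb{E}_{\mathtt{R}}\big[\tfrac{Z_\tau}{Z_t}Y\,\big|\,\mathcal{F}_t\big]\mathbf{1}_{\{Z_t>0\}}$ for nonnegative $\mathcal{F}_\tau$-measurable $Y$, $\tau\ge t$ a finite stopping time, with the convention $0/0:=1$. The essential supremum of a family of random variables $(Y_a)$ is the ($\mathtt{R}$-almost surely unique) $[-\infty,\infty]$-valued random variable $Y$ with $Y\ge Y_a$ $\mathtt{R}$-a.s. for every $a$ and such that any random variable $Y'$ with $Y'\ge Y_a$ $\mathtt{R}$-a.s. for every $a$ satisfies $Y'\ge Y$ $\mathtt{R}$-a.s. A fork-convex combination of two locally dominated laws $\mathtt{Q},\mathtt{Q}'$ with likelihood ratio processes $(Z_t),(Z'_t)$ is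 a law $\mathtt{Q}''$ with likelihood ratio process $$Z''_t=\begin{cases}Z_t,&t\le s,\\ hZ_t+(1-h)Z_s\dfrac{Z'_t}{Z'_s},&t>s,\end{cases}$$ for some $s\in\{0,1,2,\dots\}$ and some $\mathcal{F}_s$-measurable random variable $h$ with values in $[0,1]$ and $h=1$ on $\{Z'_s=0\}$. $\mathcal{Q}$ is fork-convex if it contains every fork-convex combination of its elements. *)

theory Defs
  imports "HOL-Probability.Probability"
begin

text \<open>
  The sample space is the space of sequences in \<open>X\<close> indexed by \<open>t \<ge> 1\<close>, with coordinates
  \<open>X\<^sub>t \<omega> = \<omega> t\<close>. Only \<open>space X\<close> and \<open>sets X\<close> of the measure \<open>X\<close> matter. Processes are indexed by
  \<open>t \<ge> 0\<close> and, being nonnegative, take values in \<^typ>\<open>ennreal\<close>.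
\<close>

definition seq_space :: "'a measure \<Rightarrow> (nat \<Rightarrow> 'a) measure" where
  "seq_space X = PiM {1..} (\<lambda>_. X)"

definition coord_filt :: "'a measure \<Rightarrow> nat \<Rightarrow> (nat \<Rightarrow> 'a) measure" where
  "coord_filt X t = sigma (space (seq_space X))
     {(\<lambda>\<omega>. \<omega> i) -` A \<inter> space (seq_space X) | i A. i \<in> {1..t} \<and> A \<in> sets X}"

definition law :: "'a measure \<Rightarrow> (nat \<Rightarrow> 'a) measure \<Rightarrow> bool" where
  "law X Q \<longleftrightarrow> prob_space Q \<and> sets Q = sets (seq_space X)"

definition adapted_proc :: "'a measure \<Rightarrow> (nat \<Rightarrow> (nat \<Rightarrow> 'a) \<Rightarrow> ennreal) \<Rightarrow> bool" where
  "adapted_proc X M \<longleftrightarrow> (\<forall>t. M t \<in> borel_measurable (coord_filt X t))"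

text \<open>
  Integrability is part of the notion of a supermartingale. Since the initial sigma-algebra is
  trivial, for a nonnegative process satisfying the other conditions it only says that the
  constant \<open>M 0\<close> is finite.
\<close>

definition nsm :: "'a measure \<Rightarrow> (nat \<Rightarrow> 'a) measure set \<Rightarrow> (nat \<Rightarrow> (nat \<Rightarrow> 'a) \<Rightarrow> ennreal) \<Rightarrow> bool" where
  "nsm X \<Q> M \<longleftrightarrow> adapted_proc X M \<and>
     (\<forall>Q\<in>\<Q>. (\<forall>t. (\<integral>\<^sup>+\<omega>. M t \<omega> \<partial>Q) < \<infinity>) \<and>
            (\<forall>s t. s \<le> t \<longrightarrow> (AE \<omega> in Q. nn_cond_exp Q (coord_filt X s) (M t) \<omega> \<le> M s \<omega>)))"

definition dominates ::
  "(nat \<Rightarrow> 'a) measure set \<Rightarrow> (nat \<Rightarrow> (nat \<Rightarrow> 'a) \<Rightarrow> ennreal) \<Rightarrow> (nat \<Rightarrow> (nat \<Rightarrow> 'a) \<Rightarrow> ennreal) \<Rightarrow> bool"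
where
  "dominates \<Q> L E \<longleftrightarrow> (\<forall>Q\<in>\<Q>. \<forall>t. AE \<omega> in Q. E t \<omega> \<le> L t \<omega>)"

definition smallest_dominating_nsm ::
  "'a measure \<Rightarrow> (nat \<Rightarrow> 'a) measure set \<Rightarrow> (nat \<Rightarrow> (nat \<Rightarrow> 'a) \<Rightarrow> ennreal) \<Rightarrow>
   (nat \<Rightarrow> (nat \<Rightarrow> 'a) \<Rightarrow> ennreal) \<Rightarrow> bool"
where
  "smallest_dominating_nsm X \<Q> E L \<longleftrightarrow> nsm X \<Q> L \<and> dominates \<Q> L E \<and>
     (\<forall>L'. nsm X \<Q> L' \<and> dominates \<Q> L' E \<longrightarrow> dominates \<Q> L' L)"

text \<open>
  Finite stopping times are the library's \<^const>\<open>stopping_time\<close> at type \<^typ>\<open>nat\<close>; possibly infinite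
  ones take values in \<^typ>\<open>enat\<close>.
\<close>

definition ext_stopping_time :: "'a measure \<Rightarrow> ((nat \<Rightarrow> 'a) \<Rightarrow> enat) \<Rightarrow> bool" where
  "ext_stopping_time X \<tau> \<longleftrightarrow> (\<forall>t::nat. Measurable.pred (coord_filt X t) (\<lambda>\<omega>. \<tau> \<omega> \<le> enat t))"

definition ext_stopped ::
  "(nat \<Rightarrow> (nat \<Rightarrow> 'a) \<Rightarrow> ennreal) \<Rightarrow> ((nat \<Rightarrow> 'a) \<Rightarrow> enat) \<Rightarrow> (nat \<Rightarrow> 'a) \<Rightarrow> ennreal"
where
  "ext_stopped E \<tau> \<omega> = (case \<tau> \<omega> of enat t \<Rightarrow> E t \<omega> | \<infinity> \<Rightarrow> limsup (\<lambda>t. E t \<omega>))"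

definition safe_e_process ::
  "'a measure \<Rightarrow> (nat \<Rightarrow> 'a) measure set \<Rightarrow> (nat \<Rightarrow> (nat \<Rightarrow> 'a) \<Rightarrow> ennreal) \<Rightarrow> bool"
where
  "safe_e_process X \<Q> E \<longleftrightarrow> adapted_proc X E \<and>
     (SUP Q\<in>\<Q>. SUP \<tau>\<in>{\<tau>. ext_stopping_time X \<tau>}. \<integral>\<^sup>+\<omega>. ext_stopped E \<tau> \<omega> \<partial>Q) \<le> 1"

definition locally_dominated ::
  "'a measure \<Rightarrow> (nat \<Rightarrow> 'a) measure \<Rightarrow> (nat \<Rightarrow> 'a) measure \<Rightarrow> bool"
where
  "locally_dominated X R P \<longleftrightarrow>
     (\<forall>t. absolutely_continuous (restr_to_subalg R (coord_filt X t)) (restr_to_subalg P (coord_filt X t)))"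

definition lik_ratio ::
  "'a measure \<Rightarrow> (nat \<Rightarrow> 'a) measure \<Rightarrow> (nat \<Rightarrow> 'a) measure \<Rightarrow> nat \<Rightarrow> (nat \<Rightarrow> 'a) \<Rightarrow> ennreal"
where
  "lik_ratio X R P t = RN_deriv (restr_to_subalg R (coord_filt X t)) (restr_to_subalg P (coord_filt X t))"

text \<open>Division with the convention \<open>0/0 = 1\<close> (on \<^typ>\<open>ennreal\<close> the library has \<open>0/0 = 0\<close>).\<close>

definition ratio1 :: "ennreal \<Rightarrow> ennreal \<Rightarrow> ennreal" where
  "ratio1 a b = (if a = 0 \<and> b = 0 then 1 else a / b)"

text \<open>
  The version, unique up to \<open>R\<close>-nullsets, of the conditional expectation under \<open>Q\<close> given time \<open>t\<close> of
  a random variable \<open>Y\<close> that is known at the finite stopping time \<open>\<tau> \<ge> t\<close>.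
\<close>

definition loc_cond_exp ::
  "'a measure \<Rightarrow> (nat \<Rightarrow> 'a) measure \<Rightarrow> (nat \<Rightarrow> 'a) measure \<Rightarrow> nat \<Rightarrow> ((nat \<Rightarrow> 'a) \<Rightarrow> nat) \<Rightarrow>
   ((nat \<Rightarrow> 'a) \<Rightarrow> ennreal) \<Rightarrow> (nat \<Rightarrow> 'a) \<Rightarrow> ennreal"
where
  "loc_cond_exp X R Q t \<tau> Y \<omega> =
     nn_cond_exp R (coord_filt X t)
       (\<lambda>\<omega>. ratio1 (lik_ratio X R Q (\<tau> \<omega>) \<omega>) (lik_ratio X R Q t \<omega>) * Y \<omega>) \<omega>
     * indicator {\<omega>. lik_ratio X R Q t \<omega> > 0} \<omega>"

definition fork_convex_comb ::
  "'a measure \<Rightarrow> (nat \<Rightarrow> 'a) measure \<Rightarrow> (nat \<Rightarrow> 'a) measure \<Rightarrow> (nat \<Rightarrow> 'a) measure \<Rightarrow>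
   (nat \<Rightarrow> 'a) measure \<Rightarrow> bool"
where
  "fork_convex_comb X R Q Q' Q'' \<longleftrightarrow> law X Q'' \<and> locally_dominated X R Q'' \<and>
     (\<exists>s. \<exists>h \<in> borel_measurable (coord_filt X s).
        (\<forall>\<omega> \<in> space (seq_space X). (0::real) \<le> h \<omega> \<and> h \<omega> \<le> 1 \<and> (lik_ratio X R Q' s \<omega> = 0 \<longrightarrow> h \<omega> = 1)) \<and>
        (\<forall>t. AE \<omega> in R. lik_ratio X R Q'' t \<omega> =
           (if t \<le> s then lik_ratio X R Q t \<omega>
            else ennreal (h \<omega>) * lik_ratio X R Q t \<omega>
               + ennreal (1 - h \<omega>) * lik_ratio X R Q s \<omega>
                   * ratio1 (lik_ratio X R Q' t \<omega>) (lik_ratio X R Q' s \<omega>))))"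

definition fork_convex :: "'a measure \<Rightarrow> (nat \<Rightarrow> 'a) measure \<Rightarrow> (nat \<Rightarrow> 'a) measure set \<Rightarrow> bool" where
  "fork_convex X R \<Q> \<longleftrightarrow>
     (\<forall>Q\<in>\<Q>. \<forall>Q'\<in>\<Q>. \<forall>Q''. fork_convex_comb X R Q Q' Q'' \<longrightarrow> Q'' \<in> \<Q>)"

text \<open>
  The essential supremum of a family of random variables, as opposed to \<^const>\<open>esssup\<close>, which is that
  of a single one. It is used below for nonnegative families, with values in \<^typ>\<open>ennreal\<close>; this
  agrees with the \<^typ>\<open>ereal\<close>-valued one except that the empty family has essential
  supremum \<open>0\<close> instead of \<open>-\<infinity>\<close>.
\<close>

definition is_ess_sup ::
  "'b measure \<Rightarrow> ('b \<Rightarrow> 'c::{order,topological_space}) set \<Rightarrow> ('b \<Rightarrow> 'c) \<Rightarrow> bool"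
where
  "is_ess_sup R \<Phi> Y \<longleftrightarrow> Y \<in> borel_measurable R \<and> (\<forall>f\<in>\<Phi>. AE \<omega> in R. f \<omega> \<le> Y \<omega>) \<and>
     (\<forall>Y' \<in> borel_measurable R. (\<forall>f\<in>\<Phi>. AE \<omega> in R. f \<omega> \<le> Y' \<omega>) \<longrightarrow> (AE \<omega> in R. Y \<omega> \<le> Y' \<omega>))"

text \<open>
  The essential suprema are only determined up to \<open>R\<close>-nullsets, so this is a predicate. The
  adaptedness condition selects, for each \<open>t\<close>, the versions measurable at time \<open>t\<close>.
\<close>

definition is_snell_envelope ::
  "'a measure \<Rightarrow> (nat \<Rightarrow> 'a) measure \<Rightarrow> (nat \<Rightarrow> 'a) measure set \<Rightarrow>
   (nat \<Rightarrow> (nat \<Rightarrow> 'a) \<Rightarrow> ennreal) \<Rightarrow> (nat \<Rightarrow> (nat \<Rightarrow> 'a) \<Rightarrow> ennreal) \<Rightarrow> bool"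
where
  "is_snell_envelope X R \<Q> E L \<longleftrightarrow> adapted_proc X L \<and>
     (\<forall>t. is_ess_sup R
        {loc_cond_exp X R Q t \<tau> (\<lambda>\<omega>. E (\<tau> \<omega>) \<omega>) | Q \<tau>.
           Q \<in> \<Q> \<and> stopping_time (coord_filt X) \<tau> \<and> (\<forall>\<omega> \<in> space (seq_space X). t \<le> \<tau> \<omega>)}
        (L t))"

end

theory Submission
  imports Defs
begin

text \<open>
  Fork-convexity makes the family of conditional expectations at time \<open>t\<close> directed upwards, for
  laws that agree with a given \<open>Q\<close> up to time \<open>t\<close>: given two laws and stopping times, follow the
  first where its conditional expectation is larger and switch to the second elsewhere. Hence
  \<open>E\<^sub>Q[L\<^sub>t | F\<^sub>s]\<close> is an increasing limit of terms \<open>E\<^sub>Q\<^sub>'[E\<^sub>\<tau> | F\<^sub>s] \<le> L\<^sub>s\<close>, which is the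
  supermartingale property. Minimality is optional stopping for the competitor, and safety of \<open>L\<close> is
  optional stopping for \<open>L\<close>, with the value at infinity handled by almost sure convergence of
  nonnegative supermartingales.
\<close>

subsection \<open>Nonnegative supermartingales\<close>

text \<open>Two kinds of null sets shape the proof. \<open>L\<close> is an essential supremum under
  \<open>R\<close>, while its supermartingale property, domination and minimality are meant under
  each law of \<open>\<Q>\<close>, and such laws may be mutually singular even on
  \<open>F t\<close>. Densities are available only on each \<open>F t\<close>, so every transfer
  concerns an \<open>F t\<close>-measurable event on the set where \<open>Z Q t\<close> is positive
  (\<open>AE_law_iff\<close>). Minimality therefore takes more than optional stopping, which bounds
  a conditional expectation only almost surely under its own law, whereas the bound is wanted under
  another law \<open>Q0\<close>. Forking first gives a law that equals \<open>Q0\<close> on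
  \<open>F t\<close> and whose conditional expectation is at least as large \<open>Q0\<close>-almost
  surely; the bound then travels through this agreement. Only forks whose \<open>h\<close> is an
  indicator occur. The requirement that \<open>h = 1\<close> where the second likelihood ratio
  vanishes takes care of itself: the prescribed version of the conditional expectation is 0 there,
  so it never strictly exceeds the first one.\<close>

lemma AE_le_from_set_nn_integral:
  assumes sub: "subalgebra M F"
    and f: "f \<in> borel_measurable F" and g: "g \<in> borel_measurable F"
    and fin: "(\<integral>\<^sup>+x. g x \<partial>M) < \<infinity>"
    and le: "\<And>B. B \<in> sets F \<Longrightarrow> (\<integral>\<^sup>+x\<in>B. f x \<partial>M) \<le> (\<integral>\<^sup>+x\<in>B. g x \<partial>M)"
  shows "AE x in M. f x \<le> (g x :: ennreal)"
proof -
  note [measurable] = f g measurable_from_subalg[OF sub f] measurable_from_subalg[OF sub g]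
  \<comment> \<open>The bad event. On it \<open>f\<close> exceeds \<open>g\<close>, yet the
    hypothesis forces the integral of the difference to be zero; finiteness of the integral of
    \<open>g\<close> makes the subtraction legitimate.\<close>
  define B where "B = {x \<in> space F. g x < f x}"
  have B: "B \<in> sets F" unfolding B_def by measurable
  then have [measurable]: "B \<in> sets M" using sub by (auto simp: subalgebra_def)
  have gB: "(\<integral>\<^sup>+x\<in>B. g x \<partial>M) < \<infinity>"
    by (rule le_less_trans[OF nn_integral_mono fin]) (auto simp: indicator_def)
  have "(\<integral>\<^sup>+x. f x * indicator B x - g x * indicator B x \<partial>M)
      = (\<integral>\<^sup>+x\<in>B. f x \<partial>M) - (\<integral>\<^sup>+x\<in>B. g x \<partial>M)"
    using gB by (intro nn_integral_diff) (measurable, auto simp: B_def indicator_def)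
  also have "\<dots> = 0" using le[OF B] gB by (simp add: diff_eq_0_iff_ennreal)
  finally have "AE x in M. f x * indicator B x - g x * indicator B x = 0"
    by (subst (asm) nn_integral_0_iff_AE) auto
  with AE_space show ?thesis
  proof eventually_elim
    case (elim x)
    then have "x \<in> space F" using sub by (simp add: subalgebra_def)
    then show ?case
      using elim by (cases "x \<in> B") (auto simp: B_def diff_eq_0_iff_ennreal not_less)
  qed
qed

section \<open>Filtered probability spaces and optional stopping\<close>

locale prob_filtration = prob_space P for P :: "'b measure" +
  fixes F :: "nat \<Rightarrow> 'b measure"
  assumes space_F: "\<And>t. space (F t) = space P"
    and sets_F: "\<And>t. sets (F t) \<subseteq> sets P"
    and sets_F_mono: "\<And>s t. s \<le> t \<Longrightarrow> sets (F s) \<subseteq> sets (F t)"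
begin

lemma subalg: "subalgebra P (F t)"
  using space_F sets_F by (auto simp: subalgebra_def)

lemma subalg_F: "s \<le> t \<Longrightarrow> subalgebra (F t) (F s)"
  using space_F sets_F_mono by (auto simp: subalgebra_def)

lemma measurable_F: "f \<in> measurable (F t) N \<Longrightarrow> f \<in> measurable P N"
  by (rule measurable_from_subalg[OF subalg])

lemma measurable_F_mono: "f \<in> measurable (F s) N \<Longrightarrow> s \<le> t \<Longrightarrow> f \<in> measurable (F t) N"
  by (rule measurable_from_subalg[OF subalg_F])

lemma finite_measure_subalgebra_F: "finite_measure_subalgebra P (F t)"
  using subalg finite_measure_axioms
  by (simp add: finite_measure_subalgebra_def finite_measure_subalgebra_axioms_def)

lemma set_nn_integral_nn_cond_exp:
  assumes B: "B \<in> sets (F t)" and [measurable]: "g \<in> borel_measurable P"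
  shows "(\<integral>\<^sup>+\<omega>\<in>B. nn_cond_exp P (F t) g \<omega> \<partial>P) = (\<integral>\<^sup>+\<omega>\<in>B. g \<omega> \<partial>P)"
proof -
  interpret S: finite_measure_subalgebra P "F t" by (rule finite_measure_subalgebra_F)
  show ?thesis
    using S.nn_cond_exp_intg[of "indicator B" g] B by (simp add: mult.commute)
qed

text \<open>The supermartingale property in integrated form, which does not require integrability.\<close>

definition set_supermartingale :: "(nat \<Rightarrow> 'b \<Rightarrow> ennreal) \<Rightarrow> bool" where
  "set_supermartingale M \<longleftrightarrow> (\<forall>t. M t \<in> borel_measurable (F t)) \<and>
     (\<forall>s t. \<forall>B\<in>sets (F s). s \<le> t \<longrightarrow> (\<integral>\<^sup>+\<omega>\<in>B. M t \<omega> \<partial>P) \<le> (\<integral>\<^sup>+\<omega>\<in>B. M s \<omega> \<partial>P))"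

text \<open>Finiteness of the integrals is what turns the bounds over all \<open>B\<close> back into
  a pointwise bound.\<close>

lemma set_supermartingale_iff:
  assumes M: "\<And>t. M t \<in> borel_measurable (F t)" and fin: "\<And>t. (\<integral>\<^sup>+\<omega>. M t \<omega> \<partial>P) < \<infinity>"
  shows "set_supermartingale M \<longleftrightarrow>
    (\<forall>s t. s \<le> t \<longrightarrow> (AE \<omega> in P. nn_cond_exp P (F s) (M t) \<omega> \<le> M s \<omega>))"
proof -
  note [measurable] = measurable_F[OF M]
  have "(AE \<omega> in P. nn_cond_exp P (F s) (M t) \<omega> \<le> M s \<omega>) \<longleftrightarrow>
    (\<forall>B\<in>sets (F s). (\<integral>\<^sup>+\<omega>\<in>B. M t \<omega> \<partial>P) \<le> (\<integral>\<^sup>+\<omega>\<in>B. M s \<omega> \<partial>P))" for s t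
  proof
    assume ae: "AE \<omega> in P. nn_cond_exp P (F s) (M t) \<omega> \<le> M s \<omega>"
    show "\<forall>B\<in>sets (F s). (\<integral>\<^sup>+\<omega>\<in>B. M t \<omega> \<partial>P) \<le> (\<integral>\<^sup>+\<omega>\<in>B. M s \<omega> \<partial>P)"
    proof
      fix B assume B: "B \<in> sets (F s)"
      show "(\<integral>\<^sup>+\<omega>\<in>B. M t \<omega> \<partial>P) \<le> (\<integral>\<^sup>+\<omega>\<in>B. M s \<omega> \<partial>P)"
        unfolding set_nn_integral_nn_cond_exp[OF B, of "M t", simplified, symmetric]
        by (rule nn_integral_mono_AE) (use ae in eventually_elim, auto intro: mult_right_mono)
    qed
  next
    assume le: "\<forall>B\<in>sets (F s). (\<integral>\<^sup>+\<omega>\<in>B. M t \<omega> \<partial>P) \<le> (\<integral>\<^sup>+\<omega>\<in>B. M s \<omega> \<partial>P)"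
    show "AE \<omega> in P. nn_cond_exp P (F s) (M t) \<omega> \<le> M s \<omega>"
      by (rule AE_le_from_set_nn_integral[OF subalg[of s]])
         (use le M fin in \<open>auto simp: set_nn_integral_nn_cond_exp\<close>)
  qed
  then show ?thesis using M by (auto simp: set_supermartingale_def)
qed

text \<open>\<open>N n\<close> is \<open>M\<close> stopped at the minimum of \<open>\<tau>\<close>
  and \<open>s + n\<close>. Its integral over \<open>B\<close> does not increase with
  \<open>n\<close>, and Fatou's lemma passes to the limit, which is why \<open>liminf\<close> stands
  for the value at infinity.\<close>

lemma supermartingale_optional_stopping:
  fixes \<tau> :: "'b \<Rightarrow> enat"
  assumes M: "set_supermartingale M"
    and \<tau>: "\<And>t::nat. Measurable.pred (F t) (\<lambda>\<omega>. \<tau> \<omega> \<le> enat t)"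
    and ge: "\<And>\<omega>. \<omega> \<in> space P \<Longrightarrow> enat s \<le> \<tau> \<omega>"
    and B: "B \<in> sets (F s)"
  shows "(\<integral>\<^sup>+\<omega>\<in>B. (case \<tau> \<omega> of enat k \<Rightarrow> M k \<omega> | \<infinity> \<Rightarrow> liminf (\<lambda>t. M t \<omega>)) \<partial>P) \<le> (\<integral>\<^sup>+\<omega>\<in>B. M s \<omega> \<partial>P)"
proof -
  define N where "N n \<omega> = (if \<tau> \<omega> \<le> enat (s + n) then M (the_enat (\<tau> \<omega>)) \<omega> else M (s + n) \<omega>)" for n \<omega>
  have MF: "M t \<in> borel_measurable (F t)" for t
    using M by (simp add: set_supermartingale_def)
  have N0: "N 0 \<omega> = M s \<omega>" if "\<omega> \<in> space P" for \<omega>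
    using ge[OF that] by (cases "\<tau> \<omega>") (auto simp: N_def)
  have NSuc: "N (Suc n) \<omega> = (if \<tau> \<omega> \<le> enat (s + n) then N n \<omega> else M (s + Suc n) \<omega>)" for n \<omega>
    by (cases "\<tau> \<omega>") (auto simp: N_def not_le le_Suc_eq)
  have NF: "N n \<in> borel_measurable (F (s + n))" for n
  proof (induction n)
    case 0
    show ?case
      using MF[of s] N0 measurable_cong[of "F s" "N 0" "M s"] by (simp add: space_F)
  next
    case (Suc n)
    have [measurable]: "N n \<in> borel_measurable (F (s + Suc n))"
      "Measurable.pred (F (s + Suc n)) (\<lambda>\<omega>. \<tau> \<omega> \<le> enat (s + n))"
      by (rule measurable_F_mono[OF Suc] measurable_F_mono[OF \<tau>], simp)+
    note [measurable] = MF[of "s + Suc n"]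
    have "(\<lambda>\<omega>. if \<tau> \<omega> \<le> enat (s + n) then N n \<omega> else M (s + Suc n) \<omega>) \<in> borel_measurable (F (s + Suc n))"
      by measurable
    then show ?case by (simp add: NSuc[abs_def])
  qed
  note [measurable] = measurable_F[OF NF] measurable_F[OF MF]
  have Bn: "B \<in> sets (F (s + n))" for n using B sets_F_mono[of s "s + n"] by auto
  have BP [measurable]: "B \<in> sets P" using B sets_F by auto
  have step: "(\<integral>\<^sup>+\<omega>\<in>B. N (Suc n) \<omega> \<partial>P) \<le> (\<integral>\<^sup>+\<omega>\<in>B. N n \<omega> \<partial>P)" for n
  proof -
    \<comment> \<open>On \<open>C\<close> the process has already stopped and \<open>N\<close> no
      longer changes; off \<open>C\<close> it makes one step of \<open>M\<close>, and
      \<open>B - C\<close> is known at time \<open>s + n\<close>, so the supermartingale inequality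
      applies there.\<close>
    define C where "C = {\<omega> \<in> space (F (s + n)). \<tau> \<omega> \<le> enat (s + n)}"
    have C: "C \<in> sets (F (s + n))" using \<tau>[of "s + n"] by (simp add: C_def pred_def)
    then have [measurable]: "C \<in> sets P" using sets_F by auto
    have C_iff: "\<omega> \<in> C \<longleftrightarrow> \<tau> \<omega> \<le> enat (s + n)" if "\<omega> \<in> space P" for \<omega>
      using that by (auto simp: C_def space_F)
    have "(\<integral>\<^sup>+\<omega>\<in>B. N (Suc n) \<omega> \<partial>P)
      = (\<integral>\<^sup>+\<omega>. N n \<omega> * indicator (B \<inter> C) \<omega> + M (s + Suc n) \<omega> * indicator (B - C) \<omega> \<partial>P)"
      by (rule nn_integral_cong) (auto simp: NSuc C_iff indicator_def)
    also have "\<dots> = (\<integral>\<^sup>+\<omega>\<in>B \<inter> C. N n \<omega> \<partial>P) + (\<integral>\<^sup>+\<omega>\<in>B - C. M (s + Suc n) \<omega> \<partial>P)"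
      by (rule nn_integral_add) auto
    also have "\<dots> \<le> (\<integral>\<^sup>+\<omega>\<in>B \<inter> C. N n \<omega> \<partial>P) + (\<integral>\<^sup>+\<omega>\<in>B - C. M (s + n) \<omega> \<partial>P)"
      using M C Bn[of n] by (intro add_left_mono) (auto simp: set_supermartingale_def)
    also have "\<dots> = (\<integral>\<^sup>+\<omega>. N n \<omega> * indicator (B \<inter> C) \<omega> + M (s + n) \<omega> * indicator (B - C) \<omega> \<partial>P)"
      by (rule nn_integral_add[symmetric]) auto
    also have "\<dots> = (\<integral>\<^sup>+\<omega>\<in>B. N n \<omega> \<partial>P)"
      by (rule nn_integral_cong) (auto simp: N_def C_iff indicator_def)
    finally show ?thesis .
  qed
  have le: "(\<integral>\<^sup>+\<omega>\<in>B. N n \<omega> \<partial>P) \<le> (\<integral>\<^sup>+\<omega>\<in>B. M s \<omega> \<partial>P)" for n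
  proof (induction n)
    case 0
    show ?case by (rule eq_refl, rule nn_integral_cong) (auto simp: N0)
  next
    case (Suc n)
    with step[of n] show ?case by (rule order_trans)
  qed
  have lim: "(case \<tau> \<omega> of enat k \<Rightarrow> M k \<omega> | \<infinity> \<Rightarrow> liminf (\<lambda>t. M t \<omega>)) \<le> liminf (\<lambda>n. N n \<omega>)" for \<omega>
  proof (cases "\<tau> \<omega>")
    case (enat k)
    have "eventually (\<lambda>n. M k \<omega> \<le> N n \<omega>) sequentially"
      using eventually_ge_at_top[of k] by eventually_elim (auto simp: N_def enat)
    then show ?thesis by (auto simp: enat intro: Liminf_bounded)
  next
    case infinity
    have "liminf (\<lambda>n. N n \<omega>) = liminf (\<lambda>n. M (n + s) \<omega>)"
      by (simp add: N_def infinity add.commute)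
    then show ?thesis using liminf_shift_k[of "\<lambda>t. M t \<omega>" s] by (simp add: infinity)
  qed
  have "(\<integral>\<^sup>+\<omega>\<in>B. (case \<tau> \<omega> of enat k \<Rightarrow> M k \<omega> | \<infinity> \<Rightarrow> liminf (\<lambda>t. M t \<omega>)) \<partial>P)
      \<le> (\<integral>\<^sup>+\<omega>. liminf (\<lambda>n. N n \<omega> * indicator B \<omega>) \<partial>P)"
    by (rule nn_integral_mono) (use lim in \<open>auto simp: indicator_def\<close>)
  also have "\<dots> \<le> liminf (\<lambda>n. \<integral>\<^sup>+\<omega>\<in>B. N n \<omega> \<partial>P)"
    by (rule nn_integral_liminf) auto
  also have "\<dots> \<le> (\<integral>\<^sup>+\<omega>\<in>B. M s \<omega> \<partial>P)"
    using le by (intro Liminf_le) auto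
  finally show ?thesis .
qed

end

section \<open>Almost sure convergence by upcrossings\<close>

text \<open>
  A trader who buys when the path falls below \<open>a\<close> and sells when it next exceeds \<open>b\<close>: whether the
  stock is held after time \<open>t\<close>, and the number of sales so far.
\<close>

primrec upcross :: "ennreal \<Rightarrow> ennreal \<Rightarrow> (nat \<Rightarrow> ennreal) \<Rightarrow> nat \<Rightarrow> bool \<times> nat" where
  "upcross a b x 0 = (x 0 < a, 0)"
| "upcross a b x (Suc t) =
     (if fst (upcross a b x t)
      then if b < x (Suc t) then (False, Suc (snd (upcross a b x t))) else (True, snd (upcross a b x t))
      else (x (Suc t) < a, snd (upcross a b x t)))"

lemma mono_upcross: "mono (\<lambda>t. snd (upcross a b x t))"
  by (simp add: mono_iff_le_Suc)

text \<open>If the number of sales stopped at \<open>n\<close>, a later visit below \<open>a\<close>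
  would leave the stock held, without a sale it would stay held, and the next visit above
  \<open>b\<close> would force a sale.\<close>

lemma upcross_unbounded:
  assumes low: "liminf x < a" and high: "b < limsup x"
  shows "\<exists>t. n \<le> snd (upcross a b x t)"
proof (induction n)
  case (Suc n)
  then obtain t where t: "n \<le> snd (upcross a b x t)" by blast
  have freq_low: "\<exists>u>t. x u < a" for t
  proof (rule ccontr)
    assume "\<not> (\<exists>u>t. x u < a)"
    then have "eventually (\<lambda>u. a \<le> x u) sequentially"
      by (intro eventually_mono[OF eventually_gt_at_top[of t]]) (metis not_less)
    then show False using low Liminf_bounded[of a x sequentially] by simp
  qed
  have freq_high: "\<exists>u>t. b < x u" for t
  proof (rule ccontr)
    assume "\<not> (\<exists>u>t. b < x u)"
    then have "eventually (\<lambda>u. x u \<le> b) sequentially"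
      by (intro eventually_mono[OF eventually_gt_at_top[of t]]) (metis not_less)
    then show False using high Limsup_bounded[of x b sequentially] by simp
  qed
  show ?case
  proof (rule ccontr)
    assume neg: "\<not> ?case"
    have const: "snd (upcross a b x u) = n" if "t \<le> u" for u
      using neg t monoD[OF mono_upcross that, of a b x] by (auto simp: not_le le_less_Suc_eq)
        (metis le_antisym le_trans less_Suc_eq_le)
    obtain v where v: "t < v" "x v < a" using freq_low by blast
    have "\<exists>u\<ge>t. fst (upcross a b x u)"
    proof (rule ccontr)
      assume no: "\<not> ?thesis"
      obtain w where w: "v = Suc w" "t \<le> w" using v by (cases v) auto
      with no have "\<not> fst (upcross a b x w)" by auto
      with w v have "fst (upcross a b x v)" by simp
      with no v show False by auto
    qed
    then obtain u where u: "t \<le> u" "fst (upcross a b x u)" by blast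
    have held: "fst (upcross a b x w)" if "u \<le> w" for w
      using that
    proof (induction rule: dec_induct)
      case (step w)
      then show ?case using const[of w] const[of "Suc w"] u by (auto split: if_splits)
    qed (rule u)
    obtain w where w: "u < w" "b < x w" using freq_high by blast
    then obtain w' where w': "w = Suc w'" "u \<le> w'" by (cases w) auto
    then show False
      using held[OF w'(2)] const[of w'] const[of w] w u by simp
  qed
qed simp

context prob_filtration
begin

text \<open>
  Doob's upcrossing argument. The trader's wealth, started from \<open>a\<close>, is at least \<open>V\<close>, because the
  profit of a sale is at least \<open>b - a\<close>; and \<open>V\<close> never increases in expectation.
\<close>

lemma AE_bounded_upcross:
  assumes M: "set_supermartingale M" and ab: "a < b" "b < top"
  shows "AE \<omega> in P. \<not> (liminf (\<lambda>t. M t \<omega>) < a \<and> b < limsup (\<lambda>t. M t \<omega>))"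
proof -
  define h where "h t \<omega> = fst (upcross a b (\<lambda>t. M t \<omega>) t)" for t \<omega>
  define k where "k t \<omega> = snd (upcross a b (\<lambda>t. M t \<omega>) t)" for t \<omega>
  have MF: "M t \<in> borel_measurable (F t)" for t
    using M by (simp add: set_supermartingale_def)
  have hS: "h (Suc t) \<omega> \<longleftrightarrow> (if h t \<omega> then \<not> b < M (Suc t) \<omega> else M (Suc t) \<omega> < a)" for t \<omega>
    by (simp add: h_def)
  have kS: "k (Suc t) \<omega> = (if h t \<omega> \<and> b < M (Suc t) \<omega> then Suc (k t \<omega>) else k t \<omega>)" for t \<omega>
    by (simp add: h_def k_def)
  have meas: "Measurable.pred (F t) (h t) \<and> k t \<in> measurable (F t) (count_space UNIV)" for t
  proof (induction t)
    case 0
    show ?case using MF[of 0] by (simp add: h_def[abs_def] k_def[abs_def])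
  next
    case (Suc t)
    have [measurable]: "Measurable.pred (F (Suc t)) (h t)" "k t \<in> measurable (F (Suc t)) (count_space UNIV)"
      using Suc measurable_F_mono[of _ t _ "Suc t"] by auto
    note [measurable] = MF[of "Suc t"]
    have "Measurable.pred (F (Suc t)) (\<lambda>\<omega>. if h t \<omega> then \<not> b < M (Suc t) \<omega> else M (Suc t) \<omega> < a)"
      "(\<lambda>\<omega>. if h t \<omega> \<and> b < M (Suc t) \<omega> then Suc (k t \<omega>) else k t \<omega>) \<in> measurable (F (Suc t)) (count_space UNIV)"
      by measurable
    then show ?case by (simp add: hS[abs_def] kS[abs_def])
  qed
  then have hF: "Measurable.pred (F t) (h t)" and [measurable]: "k t \<in> measurable P (count_space UNIV)"
    and [measurable]: "Measurable.pred P (h t)" for t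
    using measurable_F by blast+
  note [measurable] = measurable_F[OF MF]
  \<comment> \<open>The part of the wealth not in stock: a credit of \<open>b - a\<close> per sale,
    and the reserve \<open>a\<close> while no stock is held.\<close>
  define U where "U t \<omega> = (b - a) * of_nat (k t \<omega>) + (if h t \<omega> then 0 else a)" for t \<omega>
  have [measurable]: "U t \<in> borel_measurable P" for t unfolding U_def[abs_def] by measurable
  define V where "V t \<omega> = U t \<omega> + M t \<omega> * indicator {\<omega> \<in> space P. h t \<omega>} \<omega>" for t \<omega>
  \<comment> \<open>The position taken at time \<open>t\<close>, revalued at the new price, covers
    the next \<open>V\<close>. At a sale, \<open>b - a\<close> plus the restored reserve
    \<open>a\<close> make \<open>b\<close>, less than the price; at a purchase the reserve is
    exchanged for stock worth less than \<open>a\<close>.\<close>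
  have V_step: "V (Suc t) \<omega> \<le> U t \<omega> + M (Suc t) \<omega> * indicator {\<omega> \<in> space P. h t \<omega>} \<omega>" (is "_ \<le> ?r")
    if \<omega>: "\<omega> \<in> space P" for t \<omega>
  proof (cases "h t \<omega> \<and> b < M (Suc t) \<omega>")
    case True
    have "V (Suc t) \<omega> = (b - a) * of_nat (k t \<omega>) + (b - a + a)"
      using True \<omega> by (simp add: V_def U_def kS hS distrib_left algebra_simps)
    also have "\<dots> \<le> (b - a) * of_nat (k t \<omega>) + M (Suc t) \<omega>"
      using True ab by (intro add_left_mono) (auto simp: diff_add_cancel_ennreal)
    also have "\<dots> = ?r" using True \<omega> by (simp add: U_def)
    finally show ?thesis .
  next
    case False
    then show ?thesis using \<omega> by (auto simp: V_def U_def kS hS intro: add_left_mono less_imp_le)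
  qed
  \<comment> \<open>Whether stock is held is decided at time \<open>t\<close>, so the
    supermartingale inequality on that event bounds the revalued position in expectation. At time 0
    either the reserve is \<open>a\<close> or the stock is worth less than \<open>a\<close>.\<close>
  have EV: "(\<integral>\<^sup>+\<omega>. V t \<omega> \<partial>P) \<le> a" for t
  proof (induction t)
    case 0
    have "(\<integral>\<^sup>+\<omega>. V 0 \<omega> \<partial>P) \<le> (\<integral>\<^sup>+\<omega>. a \<partial>P)"
      by (rule nn_integral_mono) (auto simp: V_def U_def h_def k_def)
    then show ?case by (simp add: emeasure_space_1)
  next
    case (Suc t)
    have H: "{\<omega> \<in> space P. h t \<omega>} \<in> sets (F t)" using hF[of t] by (simp add: pred_def space_F)
    have "(\<integral>\<^sup>+\<omega>. V (Suc t) \<omega> \<partial>P) \<le> (\<integral>\<^sup>+\<omega>. U t \<omega> + M (Suc t) \<omega> * indicator {\<omega> \<in> space P. h t \<omega>} \<omega> \<partial>P)"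
      by (rule nn_integral_mono) (rule V_step)
    also have "\<dots> = (\<integral>\<^sup>+\<omega>. U t \<omega> \<partial>P) + (\<integral>\<^sup>+\<omega>\<in>{\<omega> \<in> space P. h t \<omega>}. M (Suc t) \<omega> \<partial>P)"
      by (rule nn_integral_add) auto
    also have "\<dots> \<le> (\<integral>\<^sup>+\<omega>. U t \<omega> \<partial>P) + (\<integral>\<^sup>+\<omega>\<in>{\<omega> \<in> space P. h t \<omega>}. M t \<omega> \<partial>P)"
      using M H by (intro add_left_mono) (auto simp: set_supermartingale_def)
    also have "\<dots> = (\<integral>\<^sup>+\<omega>. V t \<omega> \<partial>P)"
      unfolding V_def by (rule nn_integral_add[symmetric]) auto
    finally show ?case using Suc by simp
  qed
  \<comment> \<open>The total credit from sales has expectation at most \<open>a\<close>, and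
    \<open>a\<close> is finite because \<open>a < b\<close>. Hence almost surely only finitely many
    sales take place.\<close>
  have "(\<integral>\<^sup>+\<omega>. (SUP t. (b - a) * of_nat (k t \<omega>)) \<partial>P) = (SUP t. \<integral>\<^sup>+\<omega>. (b - a) * of_nat (k t \<omega>) \<partial>P)"
  proof (rule nn_integral_monotone_convergence_SUP)
    show "incseq (\<lambda>t \<omega>. (b - a) * of_nat (k t \<omega>))"
      using mono_upcross[of a b] by (auto simp: incseq_def le_fun_def mono_def k_def intro!: mult_left_mono)
  qed measurable
  also have "\<dots> \<le> a"
  proof (rule SUP_least)
    fix t
    have "(\<integral>\<^sup>+\<omega>. (b - a) * of_nat (k t \<omega>) \<partial>P) \<le> (\<integral>\<^sup>+\<omega>. V t \<omega> \<partial>P)"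
      by (rule nn_integral_mono) (auto simp: V_def U_def intro: order_trans[OF _ le_add_same_cancel1[THEN iffD2]])
    with EV[of t] show "(\<integral>\<^sup>+\<omega>. (b - a) * of_nat (k t \<omega>) \<partial>P) \<le> a" by simp
  qed
  finally have "(\<integral>\<^sup>+\<omega>. (SUP t. (b - a) * of_nat (k t \<omega>)) \<partial>P) \<noteq> \<infinity>"
    using ab by auto
  then have "AE \<omega> in P. (SUP t. (b - a) * of_nat (k t \<omega>)) \<noteq> \<infinity>"
    by (intro nn_integral_noteq_infinite) auto
  then show ?thesis
  proof eventually_elim
    case (elim \<omega>)
    show ?case
    proof
      assume "liminf (\<lambda>t. M t \<omega>) < a \<and> b < limsup (\<lambda>t. M t \<omega>)"
      then have unb: "\<exists>t. n \<le> k t \<omega>" for n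
        using upcross_unbounded[of "\<lambda>t. M t \<omega>" a b n] by (simp add: k_def)
      have "(b - a) * of_nat n \<le> (SUP t. (b - a) * of_nat (k t \<omega>))" for n
      proof -
        obtain t where "n \<le> k t \<omega>" using unb by blast
        then show ?thesis by (intro SUP_upper2[of t] mult_left_mono) auto
      qed
      then have "(SUP n. (b - a) * of_nat n) \<le> (SUP t. (b - a) * of_nat (k t \<omega>))"
        by (rule SUP_least)
      moreover have "(SUP n. (b - a) * of_nat n) = (top::ennreal)"
        using ab by (simp add: SUP_mult_left_ennreal[symmetric] ennreal_SUP_of_nat_eq_top ennreal_mult_top
            diff_eq_0_iff_ennreal not_le)
      ultimately show False using elim by (simp add: top_unique)
    qed
  qed
qed

text \<open>A gap between \<open>liminf\<close> and \<open>limsup\<close> contains two rational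
  levels, so countably many null sets from the upcrossing bound suffice.\<close>

lemma supermartingale_AE_liminf_eq_limsup:
  assumes M: "set_supermartingale M"
  shows "AE \<omega> in P. limsup (\<lambda>t. M t \<omega>) = liminf (\<lambda>t. M t \<omega>)"
proof -
  have "AE \<omega> in P. \<not> (liminf (\<lambda>t. M t \<omega>) < ennreal (real_of_rat q) \<and> ennreal (real_of_rat r) < limsup (\<lambda>t. M t \<omega>))"
    if "ennreal (real_of_rat q) < ennreal (real_of_rat r)" for q r
    using AE_bounded_upcross[OF M that] by simp
  then have "AE \<omega> in P. \<forall>q r. ennreal (real_of_rat q) < ennreal (real_of_rat r) \<longrightarrow>
     \<not> (liminf (\<lambda>t. M t \<omega>) < ennreal (real_of_rat q) \<and> ennreal (real_of_rat r) < limsup (\<lambda>t. M t \<omega>))"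
    by (simp add: AE_all_countable)
  then show ?thesis
  proof eventually_elim
    case (elim \<omega>)
    have "\<not> liminf (\<lambda>t. M t \<omega>) < limsup (\<lambda>t. M t \<omega>)"
    proof
      assume "liminf (\<lambda>t. M t \<omega>) < limsup (\<lambda>t. M t \<omega>)"
      then obtain q where q: "liminf (\<lambda>t. M t \<omega>) < ennreal (real_of_rat q)" "ennreal (real_of_rat q) < limsup (\<lambda>t. M t \<omega>)"
        using ennreal_rat_dense by blast
      then obtain r where "ennreal (real_of_rat q) < ennreal (real_of_rat r)" "ennreal (real_of_rat r) < limsup (\<lambda>t. M t \<omega>)"
        using ennreal_rat_dense by blast
      with q elim show False by blast
    qed
    then show ?case using Liminf_le_Limsup[of sequentially "\<lambda>t. M t \<omega>"] by (simp add: not_less antisym)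
  qed
qed

end

subsection \<open>Essential suprema\<close>

lemma inverse_one_plus_le_ennreal:
  fixes x y :: ennreal
  shows "inverse (1 + x) \<le> inverse (1 + y) \<longleftrightarrow> y \<le> x"
proof (cases x; cases y)
  fix r s :: real assume xy: "x = ennreal r" "y = ennreal s" "0 \<le> r" "0 \<le> s"
  then have "inverse (1 + x) = ennreal (inverse (1 + r))" "inverse (1 + y) = ennreal (inverse (1 + s))"
    by (simp_all add: inverse_ennreal ennreal_plus[symmetric] ennreal_1[symmetric] del: ennreal_plus ennreal_1)
  with xy show ?thesis by (simp add: inverse_le_iff_le)
qed (auto simp: top_unique ennreal_add_eq_top)

lemma ennreal_mult_divide_cancel: "b \<noteq> 0 \<Longrightarrow> b \<noteq> top \<Longrightarrow> b * (a / b) = (a :: ennreal)"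
  by (simp add: ennreal_times_divide mult.commute[of b] ennreal_mult_divide_eq)

text \<open>
  A countable subfamily attains the essential supremum: it minimises the integral of the
  bounded, strictly decreasing transform \<open>1 / (1 + y)\<close> of its supremum.
\<close>

lemma (in finite_measure) ess_sup_attained_by_sequence:
  fixes \<Phi> :: "('a \<Rightarrow> ennreal) set"
  assumes meas: "\<Phi> \<subseteq> borel_measurable M" and ne: "\<Phi> \<noteq> {}"
  shows "\<exists>c :: nat \<Rightarrow> 'a \<Rightarrow> ennreal. range c \<subseteq> \<Phi> \<and> (\<forall>f\<in>\<Phi>. AE x in M. f x \<le> (SUP n. c n x))"
proof -
  define J where "J c = (\<integral>\<^sup>+x. inverse (1 + (SUP n. c n x)) \<partial>M)" for c :: "nat \<Rightarrow> 'a \<Rightarrow> ennreal"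
  define C where "C = {c :: nat \<Rightarrow> 'a \<Rightarrow> ennreal. range c \<subseteq> \<Phi>}"
  obtain f0 where "f0 \<in> \<Phi>" using ne by blast
  then have "(\<lambda>_. f0) \<in> C" by (auto simp: C_def)
  then have "J ` C \<noteq> {}" by blast
  from ennreal_Inf_countable_INF[OF this] obtain j :: "nat \<Rightarrow> ennreal"
    where "decseq j \<and> range j \<subseteq> J ` C \<and> Inf (J ` C) = (INF m. j m)" ..
  then have j: "range j \<subseteq> J ` C" "Inf (J ` C) = (INF m. j m)" by simp_all
  have "\<forall>m. \<exists>d. d \<in> C \<and> j m = J d" using j(1) by blast
  then obtain d where "\<forall>m. d m \<in> C \<and> j m = J (d m)" by metis
  then have d: "d m \<in> C" "j m = J (d m)" for m by simp_all
  \<comment> \<open>All members of the minimising sequences \<open>d m\<close> are merged into one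
    sequence by pairing, so its supremum lies above that of each \<open>d m\<close> and
    \<open>J c\<close> attains the infimum.\<close>
  define c where "c n = d (fst (prod_decode n)) (snd (prod_decode n))" for n
  have c: "range c \<subseteq> \<Phi>" using d(1) by (auto simp: c_def C_def)
  then have cC: "c \<in> C" by (simp add: C_def)
  have J_antimono: "J c2 \<le> J c1" if "\<And>x. (SUP n. c1 n x) \<le> (SUP n. c2 n x)" for c1 c2
    unfolding J_def by (rule nn_integral_mono) (simp add: inverse_one_plus_le_ennreal that)
  have "J c \<le> J (d m)" for m
  proof (rule J_antimono)
    fix x
    have "d m n x \<le> (SUP n. c n x)" for n
      by (rule SUP_upper2[of "prod_encode (m, n)"]) (simp_all add: c_def)
    then show "(SUP n. d m n x) \<le> (SUP n. c n x)" by (rule SUP_least)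
  qed
  then have "J c \<le> Inf (J ` C)" unfolding j(2) d(2) by (rule INF_greatest)
  then have opt: "J c \<le> J c'" if "c' \<in> C" for c'
    using INF_lower[OF that, of J] by simp
  have "AE x in M. f x \<le> (SUP n. c n x)" if f: "f \<in> \<Phi>" for f
  proof -
    \<comment> \<open>Prepending \<open>f\<close> can only lower the transform pointwise, but by
      optimality it cannot lower \<open>J\<close>. So both transforms agree almost everywhere, and
      \<open>f\<close> lies below the old supremum.\<close>
    define c' where "c' = case_nat f c"
    have c': "c' \<in> C" using subsetD[OF c rangeI] f by (auto simp: C_def c'_def split: nat.splits)
    have "c n x \<le> (SUP n. c' n x)" for n x
      by (rule SUP_upper2[of "Suc n"]) (simp_all add: c'_def)
    then have sup: "(SUP n. c n x) \<le> (SUP n. c' n x)" for x by (rule SUP_least)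
    have le: "inverse (1 + (SUP n. c' n x)) \<le> inverse (1 + (SUP n. c n x))" for x
      by (simp add: inverse_one_plus_le_ennreal sup)
    have [measurable]: "c n \<in> borel_measurable M" "c' n \<in> borel_measurable M" for n
      using c c' meas by (auto simp: C_def)
    \<comment> \<open>The transform is at most 1; finiteness is needed to conclude a strict
      inequality of integrals.\<close>
    have fin: "J c' \<noteq> \<infinity>"
    proof -
      have "J c' \<le> (\<integral>\<^sup>+x. 1 \<partial>M)"
        unfolding J_def
      proof (rule nn_integral_mono)
        fix x show "inverse (1 + (SUP n. c' n x)) \<le> 1"
          using inverse_one_plus_le_ennreal[of "SUP n. c' n x" 0] by simp
      qed
      then show ?thesis using emeasure_finite[of "space M"] by (auto simp: top_unique)
    qed
    have "AE x in M. inverse (1 + (SUP n. c n x)) \<le> inverse (1 + (SUP n. c' n x))"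
    proof (rule ccontr)
      assume neg: "\<not> ?thesis"
      have "J c' < J c"
        unfolding J_def
      proof (rule nn_integral_less)
        show "AE x in M. inverse (1 + (SUP n. c' n x)) \<le> inverse (1 + (SUP n. c n x))"
          using le by simp
      qed (use neg fin in \<open>simp_all add: J_def\<close>)
      with opt[OF c'] show False by simp
    qed
    then show ?thesis
    proof eventually_elim
      case (elim x)
      have "f x \<le> (SUP n. c' n x)" by (rule SUP_upper2[of 0]) (auto simp: c'_def)
      with elim show ?case by (simp add: inverse_one_plus_le_ennreal)
    qed
  qed
  with c show ?thesis by blast
qed

subsection \<open>Likelihood ratios and conditional expectations\<close>

lemma space_coord_filt: "space (coord_filt X t) = space (seq_space X)"
  by (simp add: coord_filt_def space_measure_of_conv)

lemma sets_coord_filt: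
  "sets (coord_filt X t) = sigma_sets (space (seq_space X))
     {(\<lambda>\<omega>. \<omega> i) -` A \<inter> space (seq_space X) | i A. i \<in> {1..t} \<and> A \<in> sets X}"
  unfolding coord_filt_def by (rule sets_measure_of) auto

lemma sets_coord_filt_subset: "sets (coord_filt X t) \<subseteq> sets (seq_space X)"
  unfolding sets_coord_filt
proof (rule sets.sigma_sets_subset, safe)
  fix i A assume "i \<in> {1..t}" "A \<in> sets X"
  then show "(\<lambda>\<omega>. \<omega> i) -` A \<inter> space (seq_space X) \<in> sets (seq_space X)"
    unfolding seq_space_def by (intro measurable_sets[OF measurable_component_singleton]) auto
qed

lemma sets_coord_filt_mono: "s \<le> t \<Longrightarrow> sets (coord_filt X s) \<subseteq> sets (coord_filt X t)"
  unfolding sets_coord_filt by (rule sigma_sets_mono') fastforce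

text \<open>Since \<open>{1..0}\<close> is empty there are no generators and the sigma-algebra is
  trivial, so the level set of \<open>f\<close> through a point is everything. This later turns
  almost sure bounds at time 0 into pointwise ones.\<close>

lemma measurable_coord_filt_0_const:
  assumes f: "f \<in> borel_measurable (coord_filt X 0)" and "\<omega> \<in> space (seq_space X)" "\<omega>' \<in> space (seq_space X)"
  shows "f \<omega> = (f \<omega>' :: 'b :: t1_space)"
proof -
  have "f -` {f \<omega>} \<inter> space (coord_filt X 0) \<in> sets (coord_filt X 0)"
    by (rule measurable_sets[OF f]) simp
  then have "f -` {f \<omega>} \<inter> space (seq_space X) \<in> {{}, space (seq_space X)}"
    by (simp add: space_coord_filt sets_coord_filt sigma_sets_empty_eq)
  moreover have "\<omega> \<in> f -` {f \<omega>} \<inter> space (seq_space X)" using assms by simp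
  ultimately have "f -` {f \<omega>} \<inter> space (seq_space X) = space (seq_space X)" by blast
  then have "\<omega>' \<in> f -` {f \<omega>}" using assms(3) by blast
  then show ?thesis by simp
qed

lemma law_prob_filtration: "law X Q \<Longrightarrow> prob_filtration Q (coord_filt X)"
  using sets_coord_filt_subset subsetD[OF sets_coord_filt_mono] sets_eq_imp_space_eq[of Q "seq_space X"]
  by (auto simp: law_def prob_filtration_def prob_filtration_axioms_def space_coord_filt)

lemma space_law: "law X Q \<Longrightarrow> space Q = space (seq_space X)"
  by (auto simp: law_def dest: sets_eq_imp_space_eq)

lemma stopping_time_eq_measurable:
  assumes \<tau>: "stopping_time (coord_filt X) \<tau>" shows "Measurable.pred (coord_filt X t) (\<lambda>\<omega>. \<tau> \<omega> = t)"
proof (cases t)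
  case 0
  then show ?thesis using stopping_timeD[OF \<tau>, of 0] by simp
next
  case (Suc s)
  note [measurable] = stopping_timeD[OF \<tau>, of t]
  have "Measurable.pred (coord_filt X t) (\<lambda>\<omega>. \<tau> \<omega> \<le> s)"
    using stopping_timeD[OF \<tau>, of s] sets_coord_filt_mono[of s t X] Suc
    by (auto simp: pred_def space_coord_filt)
  then have "Measurable.pred (coord_filt X t) (\<lambda>\<omega>. \<tau> \<omega> \<le> t \<and> \<not> \<tau> \<omega> \<le> s)"
    by measurable
  also have "(\<lambda>\<omega>. \<tau> \<omega> \<le> t \<and> \<not> \<tau> \<omega> \<le> s) = (\<lambda>\<omega>. \<tau> \<omega> = t)" using Suc by auto
  finally show ?thesis .
qed

lemma measurable_stopped_value:
  assumes Y: "adapted_proc X Y" and \<tau>: "stopping_time (coord_filt X) \<tau>"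
  shows "(\<lambda>\<omega>. Y (\<tau> \<omega>) \<omega>) \<in> borel_measurable (seq_space X)"
proof -
  have sub: "subalgebra (seq_space X) (coord_filt X t)" for t
    by (simp add: subalgebra_def space_coord_filt sets_coord_filt_subset)
  have [measurable]: "Y t \<in> borel_measurable (seq_space X)" for t
    using Y measurable_from_subalg[OF sub] by (auto simp: adapted_proc_def)
  have "\<tau> -` {t} \<inter> space (seq_space X) \<in> sets (seq_space X)" for t
    using stopping_time_eq_measurable[OF \<tau>, of t] sets_coord_filt_subset[of X t]
    by (auto simp: pred_def space_coord_filt vimage_def Collect_conj_eq Int_commute)
  then have [measurable]: "\<tau> \<in> measurable (seq_space X) (count_space UNIV)"
    by (simp add: measurable_count_space_eq2_countable)
  show ?thesis by (rule measurable_compose_countable) auto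
qed

section \<open>Change of measure at fixed times and at finite stopping times\<close>

locale reference_law =
  fixes X :: "'a measure" and R :: "(nat \<Rightarrow> 'a) measure"
  assumes law_R: "law X R"
begin

abbreviation "F \<equiv> coord_filt X"

abbreviation "Z \<equiv> lik_ratio X R"

definition dom_law :: "(nat \<Rightarrow> 'a) measure \<Rightarrow> bool" where
  "dom_law Q \<longleftrightarrow> law X Q \<and> locally_dominated X R Q"

sublocale prob_filtration R F
  by (rule law_prob_filtration[OF law_R])

lemma measurable_law: "dom_law Q \<Longrightarrow> f \<in> measurable (F t) N \<Longrightarrow> f \<in> measurable Q N"
  using prob_filtration.measurable_F[OF law_prob_filtration] by (auto simp: dom_law_def)

lemma borel_measurable_lik_ratio: "Z Q t \<in> borel_measurable (F t)"
proof -
  have "Z Q t \<in> borel_measurable (restr_to_subalg R (F t))"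
    unfolding lik_ratio_def by (rule borel_measurable_RN_deriv)
  then show ?thesis using sets_restr_to_subalg[OF subalg[of t]] by (simp cong: measurable_cong_sets)
qed

text \<open>Local domination yields densities only for the restrictions to \<open>F t\<close>, hence
  the measurability demanded of \<open>f\<close>; \<open>Q\<close> itself need not be absolutely
  continuous with respect to \<open>R\<close>. Finiteness of \<open>Z\<close> will allow cancelling
  it.\<close>

lemma
  assumes Q: "dom_law Q"
  shows nn_integral_lik_ratio: "f \<in> borel_measurable (F t) \<Longrightarrow> (\<integral>\<^sup>+\<omega>. f \<omega> \<partial>Q) = (\<integral>\<^sup>+\<omega>. Z Q t \<omega> * f \<omega> \<partial>R)"
    and AE_lik_ratio_finite: "AE \<omega> in R. Z Q t \<omega> \<noteq> \<infinity>"
proof -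
  interpret Q: prob_filtration Q F using Q by (intro law_prob_filtration) (simp add: dom_law_def)
  interpret RR: prob_space "restr_to_subalg R (F t)"
    by (rule prob_space_restr_to_subalg[OF subalg prob_space_axioms])
  interpret QQ: prob_space "restr_to_subalg Q (F t)"
    by (rule prob_space_restr_to_subalg[OF Q.subalg Q.prob_space_axioms])
  have ac: "absolutely_continuous (restr_to_subalg R (F t)) (restr_to_subalg Q (F t))"
    using Q by (simp add: dom_law_def locally_dominated_def)
  have eq: "sets (restr_to_subalg Q (F t)) = sets (restr_to_subalg R (F t))"
    by (simp add: sets_restr_to_subalg subalg Q.subalg)
  show "(\<integral>\<^sup>+\<omega>. f \<omega> \<partial>Q) = (\<integral>\<^sup>+\<omega>. Z Q t \<omega> * f \<omega> \<partial>R)" if f: "f \<in> borel_measurable (F t)"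
  proof -
    note [measurable] = f borel_measurable_lik_ratio[of Q t]
    have "(\<integral>\<^sup>+\<omega>. f \<omega> \<partial>Q) = (\<integral>\<^sup>+\<omega>. f \<omega> \<partial>restr_to_subalg Q (F t))"
      by (rule nn_integral_subalgebra2[OF Q.subalg f, symmetric])
    also have "\<dots> = (\<integral>\<^sup>+\<omega>. Z Q t \<omega> * f \<omega> \<partial>restr_to_subalg R (F t))"
      unfolding lik_ratio_def
      by (rule RR.RN_deriv_nn_integral[OF ac eq measurable_in_subalg[OF subalg f]])
    also have "\<dots> = (\<integral>\<^sup>+\<omega>. Z Q t \<omega> * f \<omega> \<partial>R)"
      by (rule nn_integral_subalgebra2[OF subalg]) measurable
    finally show ?thesis .
  qed
  show "AE \<omega> in R. Z Q t \<omega> \<noteq> \<infinity>"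
    using RR.RN_deriv_finite[OF QQ.sigma_finite_measure_axioms ac eq]
    unfolding lik_ratio_def by (rule AE_restr_to_subalg[OF subalg])
qed

text \<open>Used for the forked law: a density found by hand is the likelihood ratio, and its
  existence proves local domination at the same time.\<close>

lemma lik_ratio_unique:
  assumes Q: "law X Q" and f: "f \<in> borel_measurable (F t)"
    and eq: "\<And>B. B \<in> sets (F t) \<Longrightarrow> emeasure Q B = (\<integral>\<^sup>+\<omega>\<in>B. f \<omega> \<partial>R)"
  shows "AE \<omega> in R. Z Q t \<omega> = f \<omega>"
    and "absolutely_continuous (restr_to_subalg R (F t)) (restr_to_subalg Q (F t))"
proof -
  interpret Q: prob_filtration Q F using Q by (intro law_prob_filtration)
  interpret RR: prob_space "restr_to_subalg R (F t)"
    by (rule prob_space_restr_to_subalg[OF subalg prob_space_axioms])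
  have fR: "f \<in> borel_measurable (restr_to_subalg R (F t))" by (rule measurable_in_subalg[OF subalg f])
  have "density (restr_to_subalg R (F t)) f = restr_to_subalg Q (F t)"
  proof (rule measure_eqI)
    fix B assume "B \<in> sets (density (restr_to_subalg R (F t)) f)"
    then have B: "B \<in> sets (F t)" by (simp add: sets_restr_to_subalg subalg)
    then show "emeasure (density (restr_to_subalg R (F t)) f) B = emeasure (restr_to_subalg Q (F t)) B"
      using fR f eq[OF B]
      by (simp add: emeasure_density sets_restr_to_subalg subalg emeasure_restr_to_subalg Q.subalg
          nn_integral_subalgebra2)
  qed (simp add: sets_restr_to_subalg subalg Q.subalg)
  note dens = this
  show "absolutely_continuous (restr_to_subalg R (F t)) (restr_to_subalg Q (F t))"
    unfolding dens[symmetric] by (rule absolutely_continuousI_density[OF fR])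
  have "AE \<omega> in R. f \<omega> = Z Q t \<omega>"
    unfolding lik_ratio_def
    by (rule AE_restr_to_subalg[OF subalg RR.RN_deriv_unique[OF fR dens]])
  then show "AE \<omega> in R. Z Q t \<omega> = f \<omega>" by eventually_elim simp
qed

text \<open>The failure set of \<open>p\<close> is \<open>Q\<close>-null exactly when
  \<open>Z Q t\<close> vanishes \<open>R\<close>-almost everywhere on it. This is the bridge between
  essential suprema under \<open>R\<close> and statements under a law of
  \<open>\<Q>\<close>.\<close>

lemma AE_law_iff:
  assumes Q: "dom_law Q" and p: "Measurable.pred (F t) p"
  shows "(AE \<omega> in Q. p \<omega>) \<longleftrightarrow> (AE \<omega> in R. 0 < Z Q t \<omega> \<longrightarrow> p \<omega>)"
proof -
  note [measurable] = p borel_measurable_lik_ratio[of Q t] measurable_F[OF p]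
    measurable_law[OF Q p] measurable_F[OF borel_measurable_lik_ratio[of Q t]]
  have "(AE \<omega> in Q. p \<omega>) \<longleftrightarrow> (\<integral>\<^sup>+\<omega>. indicator {\<omega>. \<not> p \<omega>} \<omega> \<partial>Q) = 0"
    by (rule AE_iff_nn_integral) measurable
  also have "\<dots> \<longleftrightarrow> (\<integral>\<^sup>+\<omega>. Z Q t \<omega> * indicator {\<omega>. \<not> p \<omega>} \<omega> \<partial>R) = 0"
    by (subst nn_integral_lik_ratio[OF Q, of _ t]) auto
  also have "\<dots> \<longleftrightarrow> (AE \<omega> in R. Z Q t \<omega> * indicator {\<omega>. \<not> p \<omega>} \<omega> = 0)"
    by (rule nn_integral_0_iff_AE) measurable
  also have "\<dots> \<longleftrightarrow> (AE \<omega> in R. 0 < Z Q t \<omega> \<longrightarrow> p \<omega>)"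
    by (intro AE_cong) (auto simp: indicator_def zero_less_iff_neq_zero)
  finally show ?thesis .
qed

lemma AE_lik_ratio_pos: "dom_law Q \<Longrightarrow> AE \<omega> in Q. 0 < Z Q t \<omega>"
  using borel_measurable_lik_ratio[of Q t] by (subst AE_law_iff[where t = t]) auto

text \<open>On \<open>\<tau> = k\<close> the integrand is \<open>F k\<close>-measurable and the
  density \<open>Z Q k\<close> applies; summing over \<open>k\<close> assembles \<open>Z Q\<close>
  at \<open>\<tau>\<close>. So the change of measure reaches finite stopping times without a density
  on the whole space.\<close>

lemma nn_integral_stopped_value:
  assumes Q: "dom_law Q" and Y: "adapted_proc X Y" and \<tau>: "stopping_time F \<tau>"
    and ge: "\<And>\<omega>. \<omega> \<in> space (seq_space X) \<Longrightarrow> t \<le> \<tau> \<omega>" and g: "g \<in> borel_measurable (F t)"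
  shows "(\<integral>\<^sup>+\<omega>. g \<omega> * Y (\<tau> \<omega>) \<omega> \<partial>Q) = (\<integral>\<^sup>+\<omega>. g \<omega> * (Z Q (\<tau> \<omega>) \<omega> * Y (\<tau> \<omega>) \<omega>) \<partial>R)"
proof -
  \<comment> \<open>For \<open>k < t\<close> the factor \<open>g\<close> need not be
    \<open>F k\<close>-measurable, but then \<open>u k\<close> is zero because \<open>\<tau>\<close>
    is at least \<open>t\<close>.\<close>
  define u where "u k \<omega> = (if k = \<tau> \<omega> then g \<omega> * Y k \<omega> else 0)" for k \<omega>
  have u: "u k \<in> borel_measurable (F k)" for k
  proof (cases "t \<le> k")
    case True
    have [measurable]: "Measurable.pred (F k) (\<lambda>\<omega>. k = \<tau> \<omega>)"
      using stopping_time_eq_measurable[OF \<tau>, of k] by (simp add: eq_commute)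
    note [measurable] = measurable_F_mono[OF g True]
    have [measurable]: "Y k \<in> borel_measurable (F k)" using Y by (simp add: adapted_proc_def)
    show ?thesis unfolding u_def[abs_def] by measurable
  next
    case False
    have "u k \<in> borel_measurable (F k) \<longleftrightarrow> (\<lambda>_. 0 :: ennreal) \<in> borel_measurable (F k)"
      using ge False by (intro measurable_cong) (auto simp: u_def space_coord_filt)
    then show ?thesis by simp
  qed
  note [measurable] = measurable_F[OF u] measurable_law[OF Q u] measurable_F[OF borel_measurable_lik_ratio]
  have single: "(\<Sum>k. if k = \<tau> \<omega> then v k else 0) = v (\<tau> \<omega>)" for v :: "nat \<Rightarrow> ennreal" and \<omega>
    using sums_single[of "\<tau> \<omega>" v] by (simp add: sums_iff)
  have "(\<integral>\<^sup>+\<omega>. g \<omega> * Y (\<tau> \<omega>) \<omega> \<partial>Q) = (\<integral>\<^sup>+\<omega>. (\<Sum>k. u k \<omega>) \<partial>Q)"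
    unfolding u_def single ..
  also have "\<dots> = (\<Sum>k. \<integral>\<^sup>+\<omega>. u k \<omega> \<partial>Q)"
    by (rule nn_integral_suminf) measurable
  also have "\<dots> = (\<Sum>k. \<integral>\<^sup>+\<omega>. Z Q k \<omega> * u k \<omega> \<partial>R)"
    by (intro arg_cong[of _ _ suminf] ext nn_integral_lik_ratio[OF Q u])
  also have "\<dots> = (\<integral>\<^sup>+\<omega>. (\<Sum>k. Z Q k \<omega> * u k \<omega>) \<partial>R)"
    by (rule nn_integral_suminf[symmetric]) measurable
  also have "\<dots> = (\<integral>\<^sup>+\<omega>. g \<omega> * (Z Q (\<tau> \<omega>) \<omega> * Y (\<tau> \<omega>) \<omega>) \<partial>R)"
  proof (rule nn_integral_cong)
    fix \<omega>
    have "(\<Sum>k. Z Q k \<omega> * u k \<omega>) = (\<Sum>k. if k = \<tau> \<omega> then Z Q k \<omega> * (g \<omega> * Y k \<omega>) else 0)"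
      by (intro arg_cong[of _ _ suminf] ext) (simp add: u_def)
    then show "(\<Sum>k. Z Q k \<omega> * u k \<omega>) = g \<omega> * (Z Q (\<tau> \<omega>) \<omega> * Y (\<tau> \<omega>) \<omega>)"
      by (simp add: single mult_ac)
  qed
  finally show ?thesis .
qed

lemma borel_measurable_loc_cond_exp: "loc_cond_exp X R Q t \<tau> Y \<in> borel_measurable (F t)"
proof -
  note [measurable] = borel_measurable_lik_ratio[of Q t]
  show ?thesis unfolding loc_cond_exp_def[abs_def] by measurable
qed

text \<open>The prescribed \<open>R\<close>-version has the defining property of a conditional
  expectation under \<open>Q\<close>: passing to \<open>R\<close> brings a factor
  \<open>Z Q t\<close>, which cancels the denominator where it is positive and finite, and the
  remaining \<open>Z Q\<close> at \<open>\<tau>\<close> leads back to \<open>Q\<close>. The set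
  where \<open>Z Q t\<close> vanishes is \<open>Q\<close>-null.\<close>

lemma nn_integral_loc_cond_exp:
  assumes Q: "dom_law Q" and Y: "adapted_proc X Y" and \<tau>: "stopping_time F \<tau>"
    and ge: "\<And>\<omega>. \<omega> \<in> space (seq_space X) \<Longrightarrow> t \<le> \<tau> \<omega>" and g: "g \<in> borel_measurable (F t)"
  shows "(\<integral>\<^sup>+\<omega>. g \<omega> * loc_cond_exp X R Q t \<tau> (\<lambda>\<omega>. Y (\<tau> \<omega>) \<omega>) \<omega> \<partial>Q) = (\<integral>\<^sup>+\<omega>. g \<omega> * Y (\<tau> \<omega>) \<omega> \<partial>Q)"
proof -
  interpret S: finite_measure_subalgebra R "F t" by (rule finite_measure_subalgebra_F)
  have setsR: "sets R = sets (seq_space X)" and setsQ: "sets Q = sets (seq_space X)"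
    using law_R Q by (simp_all add: dom_law_def law_def)
  note [measurable] = g borel_measurable_lik_ratio[of Q t] borel_measurable_loc_cond_exp[of Q t]
  note [measurable] = measurable_F[OF borel_measurable_lik_ratio]
  have "adapted_proc X (Z Q)" by (simp add: adapted_proc_def borel_measurable_lik_ratio)
  then have [measurable]: "(\<lambda>\<omega>. Z Q (\<tau> \<omega>) \<omega>) \<in> borel_measurable R" "(\<lambda>\<omega>. Y (\<tau> \<omega>) \<omega>) \<in> borel_measurable R"
    using measurable_stopped_value[OF _ \<tau>] Y setsR by (auto cong: measurable_cong_sets)
  define I where "I \<omega> = (indicator {\<omega>. 0 < Z Q t \<omega>} \<omega> :: ennreal)" for \<omega>
  define W where "W \<omega> = ratio1 (Z Q (\<tau> \<omega>) \<omega>) (Z Q t \<omega>) * Y (\<tau> \<omega>) \<omega>" for \<omega>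
  have [measurable]: "I \<in> borel_measurable (F t)" unfolding I_def[abs_def] by measurable
  have [measurable]: "W \<in> borel_measurable R" unfolding W_def[abs_def] ratio1_def by measurable
  have "(\<integral>\<^sup>+\<omega>. g \<omega> * loc_cond_exp X R Q t \<tau> (\<lambda>\<omega>. Y (\<tau> \<omega>) \<omega>) \<omega> \<partial>Q)
      = (\<integral>\<^sup>+\<omega>. Z Q t \<omega> * (g \<omega> * loc_cond_exp X R Q t \<tau> (\<lambda>\<omega>. Y (\<tau> \<omega>) \<omega>) \<omega>) \<partial>R)"
    by (rule nn_integral_lik_ratio[OF Q]) measurable
  also have "\<dots> = (\<integral>\<^sup>+\<omega>. (Z Q t \<omega> * g \<omega> * I \<omega>) * nn_cond_exp R (F t) W \<omega> \<partial>R)"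
    unfolding loc_cond_exp_def I_def[symmetric] W_def[symmetric] by (simp add: mult_ac)
  also have "\<dots> = (\<integral>\<^sup>+\<omega>. (Z Q t \<omega> * g \<omega> * I \<omega>) * W \<omega> \<partial>R)"
    by (rule S.nn_cond_exp_intg) measurable
  also have "\<dots> = (\<integral>\<^sup>+\<omega>. (g \<omega> * I \<omega>) * (Z Q (\<tau> \<omega>) \<omega> * Y (\<tau> \<omega>) \<omega>) \<partial>R)"
  proof (rule nn_integral_cong_AE, use AE_lik_ratio_finite[OF Q, of t] in eventually_elim)
    case (elim \<omega>)
    show ?case
    proof (cases "Z Q t \<omega> = 0")
      case False
      then have "Z Q t \<omega> * (Z Q (\<tau> \<omega>) \<omega> / Z Q t \<omega>) = Z Q (\<tau> \<omega>) \<omega>"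
        using elim by (simp add: ennreal_mult_divide_cancel)
      then have W: "Z Q t \<omega> * W \<omega> = Z Q (\<tau> \<omega>) \<omega> * Y (\<tau> \<omega>) \<omega>"
        using False by (simp add: W_def ratio1_def mult.assoc[symmetric])
      have "(Z Q t \<omega> * g \<omega> * I \<omega>) * W \<omega> = (g \<omega> * I \<omega>) * (Z Q t \<omega> * W \<omega>)" by (simp add: mult_ac)
      then show ?thesis by (simp only: W)
    qed (simp add: I_def)
  qed
  also have "\<dots> = (\<integral>\<^sup>+\<omega>. (g \<omega> * I \<omega>) * Y (\<tau> \<omega>) \<omega> \<partial>Q)"
    by (rule nn_integral_stopped_value[OF Q Y \<tau> ge, symmetric]) measurable
  also have "\<dots> = (\<integral>\<^sup>+\<omega>. g \<omega> * Y (\<tau> \<omega>) \<omega> \<partial>Q)"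
    by (rule nn_integral_cong_AE, use AE_lik_ratio_pos[OF Q, of t] in eventually_elim) (simp add: I_def)
  finally show ?thesis .
qed

end

subsection \<open>Forking\<close>

lemma pred_ennreal_le [measurable (raw)]:
  fixes f g :: "'b \<Rightarrow> ennreal"
  assumes "f \<in> borel_measurable M" "g \<in> borel_measurable M"
  shows "Measurable.pred M (\<lambda>x. f x \<le> g x)"
  unfolding pred_def using assms by (rule borel_measurable_le)

context reference_law
begin

text \<open>Equality of the restrictions to \<open>F t\<close>, put in the form in which one law is
  later exchanged for another under an integral.\<close>

definition agree_upto :: "nat \<Rightarrow> (nat \<Rightarrow> 'a) measure \<Rightarrow> (nat \<Rightarrow> 'a) measure \<Rightarrow> bool" where
  "agree_upto t Q Q' \<longleftrightarrow> (\<forall>f\<in>borel_measurable (F t). (\<integral>\<^sup>+\<omega>. f \<omega> \<partial>Q) = (\<integral>\<^sup>+\<omega>. f \<omega> \<partial>Q'))"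

lemma agree_upto_AE:
  assumes "agree_upto t Q Q'" and Q: "dom_law Q" "dom_law Q'" and p: "Measurable.pred (F t) p"
  shows "(AE \<omega> in Q. p \<omega>) \<longleftrightarrow> (AE \<omega> in Q'. p \<omega>)"
proof -
  note [measurable] = p measurable_law[OF Q(1) p] measurable_law[OF Q(2) p]
  have "(AE \<omega> in Q. p \<omega>) \<longleftrightarrow> (\<integral>\<^sup>+\<omega>. indicator {\<omega>. \<not> p \<omega>} \<omega> \<partial>Q) = 0"
    by (rule AE_iff_nn_integral) measurable
  also have "(\<integral>\<^sup>+\<omega>. indicator {\<omega>. \<not> p \<omega>} \<omega> \<partial>Q) = (\<integral>\<^sup>+\<omega>. indicator {\<omega>. \<not> p \<omega>} \<omega> \<partial>Q')"
    using assms(1) unfolding agree_upto_def by (rule bspec) measurable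
  also have "\<dots> = 0 \<longleftrightarrow> (AE \<omega> in Q'. p \<omega>)"
    by (rule AE_iff_nn_integral[symmetric]) measurable
  finally show ?thesis .
qed

text \<open>
  Follow \<open>Q1\<close> on \<open>A\<close> and switch to \<open>Q2\<close> at time \<open>t\<close> off \<open>A\<close>. No extension theorem is needed: the
  forked law is a sum of a restriction of \<open>Q1\<close> and a measure with density \<open>Z Q1 t / Z Q2 t\<close>
  with respect to \<open>Q2\<close>. The sum is expressed as a bind over \<open>bool\<close>.
\<close>

lemma fork_exists:
  assumes Q1: "dom_law Q1" and Q2: "dom_law Q2" and A: "A \<in> sets (F t)"
    and pos_off_A: "\<forall>\<omega>\<in>space (seq_space X). \<omega> \<notin> A \<longrightarrow> Z Q2 t \<omega> \<noteq> 0"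
  shows "\<exists>Q3 w. dom_law Q3 \<and> fork_convex_comb X R Q1 Q2 Q3 \<and> agree_upto t Q1 Q3 \<and>
    w \<in> borel_measurable (F t) \<and> (\<forall>\<omega>\<in>A. w \<omega> = 0) \<and> (\<forall>f\<in>borel_measurable (seq_space X).
      (\<integral>\<^sup>+\<omega>. f \<omega> \<partial>Q3) = (\<integral>\<^sup>+\<omega>. indicator A \<omega> * f \<omega> \<partial>Q1) + (\<integral>\<^sup>+\<omega>. w \<omega> * f \<omega> \<partial>Q2))"
proof -
  note pos = pos_off_A[rule_format]
  define S where "S = seq_space X"
  interpret Q1: prob_filtration Q1 F using Q1 by (intro law_prob_filtration) (simp add: dom_law_def)
  interpret Q2: prob_filtration Q2 F using Q2 by (intro law_prob_filtration) (simp add: dom_law_def)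
  have sets_eq [measurable_cong]: "sets Q1 = sets S" "sets Q2 = sets S" "sets R = sets S"
    using law_R Q1 Q2 by (simp_all add: dom_law_def law_def S_def)
  have space_eq: "space Q1 = space S" "space Q2 = space S" "space R = space S"
    by (rule sets_eq_imp_space_eq, rule sets_eq)+
  have FS: "f \<in> measurable S N" if "f \<in> measurable (F u) N" for f u and N :: "'c measure"
    using measurable_F[OF that] sets_eq(3) by (simp cong: measurable_cong_sets)
  have AS [measurable]: "A \<in> sets S" using A sets_coord_filt_subset[of X t] by (auto simp: S_def)
  note [measurable] = A
  note Zm [measurable] = borel_measurable_lik_ratio[of _ t]
  \<comment> \<open>The density on \<open>F t\<close> of \<open>Q1\<close> with respect to
    \<open>Q2\<close>, cut off on \<open>A\<close>. By \<open>pos_off_A\<close> the denominator is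
    nonzero wherever it is used, so \<open>Q2\<close> weighted by \<open>w\<close> has, on
    \<open>F t\<close>, the mass that \<open>Q1\<close> has off \<open>A\<close>.\<close>
  define w where "w \<omega> = (if \<omega> \<in> A then 0 else Z Q1 t \<omega> / Z Q2 t \<omega>)" for \<omega>
  have w [measurable]: "w \<in> borel_measurable (F t)" unfolding w_def[abs_def] by measurable
  note wS [measurable] = FS[OF w]
  have w_int: "(\<integral>\<^sup>+\<omega>. w \<omega> * g \<omega> \<partial>Q2) = (\<integral>\<^sup>+\<omega>. (1 - indicator A \<omega>) * g \<omega> \<partial>Q1)"
    if [measurable]: "g \<in> borel_measurable (F t)" for g
  proof -
    have "(\<integral>\<^sup>+\<omega>. w \<omega> * g \<omega> \<partial>Q2) = (\<integral>\<^sup>+\<omega>. Z Q2 t \<omega> * (w \<omega> * g \<omega>) \<partial>R)"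
      by (rule nn_integral_lik_ratio[OF Q2]) measurable
    also have "\<dots> = (\<integral>\<^sup>+\<omega>. Z Q1 t \<omega> * ((1 - indicator A \<omega>) * g \<omega>) \<partial>R)"
    proof (rule nn_integral_cong_AE, use AE_lik_ratio_finite[OF Q2, of t] AE_space in eventually_elim)
      case (elim \<omega>)
      show ?case
      proof (cases "\<omega> \<in> A")
        case False
        then have "Z Q2 t \<omega> * (Z Q1 t \<omega> / Z Q2 t \<omega>) = Z Q1 t \<omega>"
          using elim pos[of \<omega>]
          by (simp add: ennreal_mult_divide_cancel space_eq S_def)
        then show ?thesis using False by (simp add: w_def mult.assoc[symmetric])
      qed (simp add: w_def)
    qed
    also have "\<dots> = (\<integral>\<^sup>+\<omega>. (1 - indicator A \<omega>) * g \<omega> \<partial>Q1)"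
      by (rule nn_integral_lik_ratio[OF Q1, symmetric]) measurable
    finally show ?thesis .
  qed
  \<comment> \<open>Each piece has mass at most one, as a kernel into subprobabilities must. That
    the masses add up to one follows below from agreement with \<open>Q1\<close> on the constant
    1.\<close>
  define D where "D b = (if b then density Q1 (indicator A) else density Q2 w)" for b
  define Q3 where "Q3 = count_space (UNIV :: bool set) \<bind> D"
  have D: "D \<in> measurable (count_space UNIV) (subprob_algebra S)"
  proof -
    have "subprob_space (density Q1 (indicator A))"
    proof (rule subprob_spaceI)
      have "emeasure (density Q1 (indicator A)) (space S) = (\<integral>\<^sup>+\<omega>. indicator A \<omega> * indicator (space S) \<omega> \<partial>Q1)"
        by (subst emeasure_density) (simp_all add: sets_eq)
      also have "\<dots> \<le> (\<integral>\<^sup>+\<omega>. 1 \<partial>Q1)" by (rule nn_integral_mono) (auto simp: indicator_def)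
      finally have "emeasure (density Q1 (indicator A)) (space S) \<le> (\<integral>\<^sup>+\<omega>. 1 \<partial>Q1)" .
      then show "emeasure (density Q1 (indicator A)) (space (density Q1 (indicator A))) \<le> 1"
        using Q1.emeasure_space_1 by (simp add: space_eq)
    qed (use Q1.not_empty in simp)
    moreover have "subprob_space (density Q2 w)"
    proof (rule subprob_spaceI)
      have "emeasure (density Q2 w) (space Q2) = (\<integral>\<^sup>+\<omega>. w \<omega> * 1 \<partial>Q2)"
        by (subst emeasure_density) (auto intro!: nn_integral_cong)
      also have "\<dots> = (\<integral>\<^sup>+\<omega>. (1 - indicator A \<omega>) * 1 \<partial>Q1)" by (rule w_int) simp
      also have "\<dots> \<le> (\<integral>\<^sup>+\<omega>. 1 \<partial>Q1)" by (rule nn_integral_mono) (auto simp: indicator_def)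
      finally show "emeasure (density Q2 w) (space (density Q2 w)) \<le> 1"
        by (simp add: Q1.emeasure_space_1)
    qed (use Q2.not_empty in simp)
    ultimately show ?thesis by (auto simp: D_def space_subprob_algebra sets_eq)
  qed
  have sets3 [measurable_cong]: "sets Q3 = sets S"
    unfolding Q3_def by (rule sets_bind[OF sets_kernel[OF D]]) auto
  have int3: "(\<integral>\<^sup>+\<omega>. f \<omega> \<partial>Q3) = (\<integral>\<^sup>+\<omega>. indicator A \<omega> * f \<omega> \<partial>Q1) + (\<integral>\<^sup>+\<omega>. w \<omega> * f \<omega> \<partial>Q2)"
    if [measurable]: "f \<in> borel_measurable S" for f
    unfolding Q3_def nn_integral_bind[OF that D]
    by (simp add: nn_integral_count_space_finite UNIV_bool D_def nn_integral_density add.commute)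
  have agree: "(\<integral>\<^sup>+\<omega>. f \<omega> \<partial>Q3) = (\<integral>\<^sup>+\<omega>. f \<omega> \<partial>Q1)" if f [measurable]: "f \<in> borel_measurable (F t)" for f
  proof -
    note [measurable] = FS[OF f]
    have "(\<integral>\<^sup>+\<omega>. f \<omega> \<partial>Q3) = (\<integral>\<^sup>+\<omega>. indicator A \<omega> * f \<omega> \<partial>Q1) + (\<integral>\<^sup>+\<omega>. (1 - indicator A \<omega>) * f \<omega> \<partial>Q1)"
      by (simp add: int3 FS[OF f] w_int f)
    also have "\<dots> = (\<integral>\<^sup>+\<omega>. indicator A \<omega> * f \<omega> + (1 - indicator A \<omega>) * f \<omega> \<partial>Q1)"
      by (rule nn_integral_add[symmetric]) measurable
    also have "\<dots> = (\<integral>\<^sup>+\<omega>. f \<omega> \<partial>Q1)"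
      by (rule nn_integral_cong) (auto simp: indicator_def)
    finally show ?thesis .
  qed
  have em3: "emeasure Q3 B = (\<integral>\<^sup>+\<omega>. indicator B \<omega> \<partial>Q3)" if "B \<in> sets S" for B
    using that sets3 by simp
  have law3: "law X Q3"
  proof -
    have "emeasure Q3 (space Q3) = (\<integral>\<^sup>+\<omega>. 1 \<partial>Q3)" by simp
    also have "\<dots> = 1" by (subst agree) (simp_all add: Q1.emeasure_space_1)
    finally show ?thesis using sets3 by (auto simp: law_def S_def intro: prob_spaceI)
  qed
  \<comment> \<open>The likelihood ratio that a fork at time \<open>t\<close> with
    \<open>h = indicator A\<close> ought to have; it is checked to be the density of
    \<open>Q3\<close> on every \<open>F u\<close>.\<close>
  define l where "l u \<omega> = (if u \<le> t then Z Q1 u \<omega>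
      else ennreal (indicator A \<omega>) * Z Q1 u \<omega>
        + ennreal (1 - indicator A \<omega>) * Z Q1 t \<omega> * ratio1 (Z Q2 u \<omega>) (Z Q2 t \<omega>))" for u \<omega>
  have lF: "l u \<in> borel_measurable (F u)" for u
  proof (cases "u \<le> t")
    case False
    have [measurable]: "Z Q1 t \<in> borel_measurable (F u)" "Z Q2 t \<in> borel_measurable (F u)" "A \<in> sets (F u)"
      using False A sets_F_mono[of t u] by (auto intro: measurable_F_mono[OF Zm])
    note [measurable] = borel_measurable_lik_ratio[of _ u]
    show ?thesis using False unfolding l_def[abs_def] ratio1_def by measurable
  qed (simp add: l_def[abs_def] borel_measurable_lik_ratio)
  have l_em: "emeasure Q3 B = (\<integral>\<^sup>+\<omega>\<in>B. l u \<omega> \<partial>R)" if B [measurable]: "B \<in> sets (F u)" for u B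
  proof -
    have BS [measurable]: "B \<in> sets S" using B sets_coord_filt_subset[of X u] by (auto simp: S_def)
    note Zu [measurable] = borel_measurable_lik_ratio[of _ u]
    show ?thesis
    proof (cases "u \<le> t")
      case True
      have "B \<in> sets (F t)" using B sets_F_mono[OF True] by auto
      then have "emeasure Q3 B = (\<integral>\<^sup>+\<omega>. indicator B \<omega> \<partial>Q1)"
        unfolding em3[OF BS] by (intro agree) simp
      also have "\<dots> = (\<integral>\<^sup>+\<omega>. Z Q1 u \<omega> * indicator B \<omega> \<partial>R)"
        by (rule nn_integral_lik_ratio[OF Q1]) measurable
      finally show ?thesis using True by (simp add: l_def)
    next
      case False
      have [measurable]: "w \<in> borel_measurable (F u)" "A \<in> sets (F u)"
        using False A sets_F_mono[of t u] by (auto intro: measurable_F_mono[OF w])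
      note [measurable] = FS[OF Zu]
      have "emeasure Q3 B = (\<integral>\<^sup>+\<omega>. indicator A \<omega> * indicator B \<omega> \<partial>Q1) + (\<integral>\<^sup>+\<omega>. w \<omega> * indicator B \<omega> \<partial>Q2)"
        unfolding em3[OF BS] by (rule int3) measurable
      also have "(\<integral>\<^sup>+\<omega>. indicator A \<omega> * indicator B \<omega> \<partial>Q1) = (\<integral>\<^sup>+\<omega>. Z Q1 u \<omega> * (indicator A \<omega> * indicator B \<omega>) \<partial>R)"
        by (rule nn_integral_lik_ratio[OF Q1]) measurable
      also have "(\<integral>\<^sup>+\<omega>. w \<omega> * indicator B \<omega> \<partial>Q2) = (\<integral>\<^sup>+\<omega>. Z Q2 u \<omega> * (w \<omega> * indicator B \<omega>) \<partial>R)"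
        by (rule nn_integral_lik_ratio[OF Q2]) measurable
      also have "(\<integral>\<^sup>+\<omega>. Z Q1 u \<omega> * (indicator A \<omega> * indicator B \<omega>) \<partial>R) + (\<integral>\<^sup>+\<omega>. Z Q2 u \<omega> * (w \<omega> * indicator B \<omega>) \<partial>R)
        = (\<integral>\<^sup>+\<omega>. Z Q1 u \<omega> * (indicator A \<omega> * indicator B \<omega>) + Z Q2 u \<omega> * (w \<omega> * indicator B \<omega>) \<partial>R)"
        by (rule nn_integral_add[symmetric]) measurable
      \<comment> \<open>Off \<open>A\<close> the product of \<open>Z Q2 u\<close> and
        \<open>w\<close> is \<open>Z Q1 t\<close> times an ordinary quotient
        \<open>Z Q2 u / Z Q2 t\<close>, since the denominator is nonzero there.\<close>
      also have "\<dots> = (\<integral>\<^sup>+\<omega>\<in>B. l u \<omega> \<partial>R)"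
      proof (rule nn_integral_cong)
        fix \<omega> assume "\<omega> \<in> space R"
        then show "Z Q1 u \<omega> * (indicator A \<omega> * indicator B \<omega>) + Z Q2 u \<omega> * (w \<omega> * indicator B \<omega>) = l u \<omega> * indicator B \<omega>"
          using False pos[of \<omega>]
          by (cases "\<omega> \<in> A"; cases "\<omega> \<in> B")
            (simp_all add: l_def w_def ratio1_def space_eq S_def ennreal_times_divide mult.commute)
      qed
      finally show ?thesis .
    qed
  qed
  have dom3: "dom_law Q3"
    unfolding dom_law_def locally_dominated_def using law3 lik_ratio_unique(2)[OF law3 lF l_em] by auto
  have fork3: "fork_convex_comb X R Q1 Q2 Q3"
    unfolding fork_convex_comb_def
  proof (intro conjI exI[of _ t] bexI[of _ "indicator A"] allI ballI impI)
    show "law X Q3" "locally_dominated X R Q3" using dom3 by (auto simp: dom_law_def)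
    show "AE \<omega> in R. Z Q3 u \<omega> = (if u \<le> t then Z Q1 u \<omega>
      else ennreal (indicator A \<omega>) * Z Q1 u \<omega>
        + ennreal (1 - indicator A \<omega>) * Z Q1 t \<omega> * ratio1 (Z Q2 u \<omega>) (Z Q2 t \<omega>))" for u
      using lik_ratio_unique(1)[OF law3 lF l_em] unfolding l_def by simp
    show "indicator A \<omega> = (1 :: real)" if "\<omega> \<in> space (seq_space X)" "Z Q2 t \<omega> = 0" for \<omega>
      using pos[OF that(1)] that(2) by (cases "\<omega> \<in> A") auto
  qed auto
  show ?thesis
  proof (intro exI conjI ballI)
    show "dom_law Q3" "fork_convex_comb X R Q1 Q2 Q3" "w \<in> borel_measurable (F t)"
      by (fact dom3 fork3 w)+
    show "agree_upto t Q1 Q3" by (simp add: agree_upto_def agree)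
    show "w \<omega> = 0" if "\<omega> \<in> A" for \<omega> using that by (simp add: w_def)
  qed (simp add: int3 S_def)
qed

end

subsection \<open>The Snell envelope\<close>

locale safe_setting = reference_law +
  fixes \<Q> :: "(nat \<Rightarrow> 'a) measure set" and E :: "nat \<Rightarrow> (nat \<Rightarrow> 'a) \<Rightarrow> ennreal"
  assumes law_Q: "\<And>Q. Q \<in> \<Q> \<Longrightarrow> law X Q"
    and locally_dominated_Q: "\<And>Q. Q \<in> \<Q> \<Longrightarrow> locally_dominated X R Q"
    and fork_convex_Q: "fork_convex X R \<Q>"
    and safe_E: "safe_e_process X \<Q> E"
begin

abbreviation cond :: "(nat \<Rightarrow> 'a) measure \<Rightarrow> nat \<Rightarrow> ((nat \<Rightarrow> 'a) \<Rightarrow> nat) \<Rightarrow> (nat \<Rightarrow> 'a) \<Rightarrow> ennreal" where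
  "cond Q t \<tau> \<equiv> loc_cond_exp X R Q t \<tau> (\<lambda>\<omega>. E (\<tau> \<omega>) \<omega>)"

definition admissible :: "nat \<Rightarrow> ((nat \<Rightarrow> 'a) \<Rightarrow> nat) \<Rightarrow> bool" where
  "admissible t \<tau> \<longleftrightarrow> stopping_time F \<tau> \<and> (\<forall>\<omega>\<in>space (seq_space X). t \<le> \<tau> \<omega>)"

definition cond_family :: "nat \<Rightarrow> ((nat \<Rightarrow> 'a) \<Rightarrow> ennreal) set" where
  "cond_family t = {cond Q t \<tau> | Q \<tau>. Q \<in> \<Q> \<and> admissible t \<tau>}"

lemma dom_law_Q: "Q \<in> \<Q> \<Longrightarrow> dom_law Q"
  by (simp add: dom_law_def law_Q locally_dominated_Q)

lemma prob_filtration_Q: "Q \<in> \<Q> \<Longrightarrow> prob_filtration Q F"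
  by (rule law_prob_filtration[OF law_Q])

lemma adapted_E: "adapted_proc X E"
  using safe_E by (simp add: safe_e_process_def)

lemma admissible_const: "admissible t (\<lambda>_. t)"
  by (simp add: admissible_def stopping_time_const)

lemma nn_integral_stopped_E_le_1:
  assumes Q: "Q \<in> \<Q>" and \<tau>: "admissible t \<tau>"
  shows "(\<integral>\<^sup>+\<omega>. E (\<tau> \<omega>) \<omega> \<partial>Q) \<le> 1"
proof -
  have "ext_stopping_time X (\<lambda>\<omega>. enat (\<tau> \<omega>))"
    using \<tau> by (simp add: ext_stopping_time_def admissible_def stopping_time_def)
  then have "(\<integral>\<^sup>+\<omega>. ext_stopped E (\<lambda>\<omega>. enat (\<tau> \<omega>)) \<omega> \<partial>Q)
      \<le> (SUP Q\<in>\<Q>. SUP \<tau>\<in>{\<tau>. ext_stopping_time X \<tau>}. \<integral>\<^sup>+\<omega>. ext_stopped E \<tau> \<omega> \<partial>Q)"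
    by (intro SUP_upper2[OF Q] SUP_upper) simp
  also have "\<dots> \<le> 1" using safe_E by (simp add: safe_e_process_def)
  finally show ?thesis by (simp add: ext_stopped_def)
qed

lemma nn_integral_cond:
  assumes "Q \<in> \<Q>" "admissible t \<tau>" "g \<in> borel_measurable (F t)"
  shows "(\<integral>\<^sup>+\<omega>. g \<omega> * cond Q t \<tau> \<omega> \<partial>Q) = (\<integral>\<^sup>+\<omega>. g \<omega> * E (\<tau> \<omega>) \<omega> \<partial>Q)"
  using assms by (intro nn_integral_loc_cond_exp dom_law_Q adapted_E) (auto simp: admissible_def)

lemma set_nn_integral_cond:
  assumes "Q \<in> \<Q>" "admissible t \<tau>" "B \<in> sets (F t)"
  shows "(\<integral>\<^sup>+\<omega>\<in>B. cond Q t \<tau> \<omega> \<partial>Q) = (\<integral>\<^sup>+\<omega>\<in>B. E (\<tau> \<omega>) \<omega> \<partial>Q)"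
  using nn_integral_cond[OF assms(1,2), of "indicator B"] assms(3) by (simp add: mult.commute)

lemma nn_integral_cond_le_1:
  assumes "Q \<in> \<Q>" "admissible t \<tau>" shows "(\<integral>\<^sup>+\<omega>. cond Q t \<tau> \<omega> \<partial>Q) \<le> 1"
  using nn_integral_cond[OF assms, of "\<lambda>_. 1"] nn_integral_stopped_E_le_1[OF assms] by simp

lemma borel_measurable_stopped_E:
  assumes "admissible t \<tau>" shows "(\<lambda>\<omega>. E (\<tau> \<omega>) \<omega>) \<in> borel_measurable (seq_space X)"
  using assms by (intro measurable_stopped_value adapted_E) (simp add: admissible_def)

text \<open>The result is asymmetric: the new law continues \<open>Q1\<close>, so the maximum is
  dominated \<open>Q1\<close>-almost surely. This lets a fixed law be kept up to time
  \<open>t\<close> while later behaviour is borrowed from others.\<close>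

lemma cond_directed:
  assumes Q1: "Q1 \<in> \<Q>" and \<tau>1: "admissible t \<tau>1" and Q2: "Q2 \<in> \<Q>" and \<tau>2: "admissible t \<tau>2"
  shows "\<exists>Q3\<in>\<Q>. \<exists>\<tau>3. admissible t \<tau>3 \<and> agree_upto t Q1 Q3 \<and>
    (AE \<omega> in Q1. max (cond Q1 t \<tau>1 \<omega>) (cond Q2 t \<tau>2 \<omega>) \<le> cond Q3 t \<tau>3 \<omega>)"
proof -
  note [measurable] = borel_measurable_loc_cond_exp
  define A where "A = {\<omega> \<in> space (F t). cond Q2 t \<tau>2 \<omega> \<le> cond Q1 t \<tau>1 \<omega>}"
  have A [measurable]: "A \<in> sets (F t)" unfolding A_def by measurable
  \<comment> \<open>Off \<open>A\<close> the second conditional expectation is strictly larger,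
    hence nonzero, so the indicator in its definition forces \<open>Z Q2 t\<close> to be
    positive.\<close>
  have pos: "\<forall>\<omega>\<in>space (seq_space X). \<omega> \<notin> A \<longrightarrow> Z Q2 t \<omega> \<noteq> 0"
    by (auto simp: A_def space_coord_filt loc_cond_exp_def)
  from fork_exists[OF dom_law_Q[OF Q1] dom_law_Q[OF Q2] A pos]
  obtain Q3 w where Q3: "dom_law Q3" "fork_convex_comb X R Q1 Q2 Q3" and agree: "agree_upto t Q1 Q3"
    and w [measurable]: "w \<in> borel_measurable (F t)" and w0: "\<forall>\<omega>\<in>A. w \<omega> = 0"
    and int3: "\<forall>f\<in>borel_measurable (seq_space X).
      (\<integral>\<^sup>+\<omega>. f \<omega> \<partial>Q3) = (\<integral>\<^sup>+\<omega>. indicator A \<omega> * f \<omega> \<partial>Q1) + (\<integral>\<^sup>+\<omega>. w \<omega> * f \<omega> \<partial>Q2)"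
    by (elim exE conjE) (rule that)
  have Q3Q: "Q3 \<in> \<Q>" by (rule fork_convex_Q[unfolded fork_convex_def, rule_format, OF Q1 Q2 Q3(2)])
  interpret Q3: prob_filtration Q3 F by (rule prob_filtration_Q[OF Q3Q])
  define \<tau>3 where "\<tau>3 \<omega> = (if \<omega> \<in> A then \<tau>1 \<omega> else \<tau>2 \<omega>)" for \<omega>
  have \<tau>3: "admissible t \<tau>3"
    unfolding admissible_def
  proof
    show "\<forall>\<omega>\<in>space (seq_space X). t \<le> \<tau>3 \<omega>" using \<tau>1 \<tau>2 by (auto simp: admissible_def \<tau>3_def)
    show "stopping_time F \<tau>3"
    proof (rule stopping_timeI)
      fix u show "Measurable.pred (F u) (\<lambda>\<omega>. \<tau>3 \<omega> \<le> u)"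
      proof (cases "t \<le> u")
        case True
        have [measurable]: "A \<in> sets (F u)" using A sets_F_mono[OF True] by auto
        have [measurable]: "Measurable.pred (F u) (\<lambda>\<omega>. \<tau>1 \<omega> \<le> u)" "Measurable.pred (F u) (\<lambda>\<omega>. \<tau>2 \<omega> \<le> u)"
          using \<tau>1 \<tau>2 by (simp_all add: admissible_def stopping_time_def)
        have "Measurable.pred (F u) (\<lambda>\<omega>. if \<omega> \<in> A then \<tau>1 \<omega> \<le> u else \<tau>2 \<omega> \<le> u)" by measurable
        also have "(\<lambda>\<omega>. if \<omega> \<in> A then \<tau>1 \<omega> \<le> u else \<tau>2 \<omega> \<le> u) = (\<lambda>\<omega>. \<tau>3 \<omega> \<le> u)"
          by (auto simp: \<tau>3_def)
        finally show ?thesis .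
      next
        case False
        have "t \<le> \<tau>3 \<omega>" if "\<omega> \<in> space (F u)" for \<omega>
          using \<tau>1 \<tau>2 that by (simp add: admissible_def \<tau>3_def space_coord_filt)
        with False have "{\<omega> \<in> space (F u). \<tau>3 \<omega> \<le> u} = {}" by fastforce
        then show ?thesis by (simp only: pred_def sets.empty_sets)
      qed
    qed
  qed
  define W where "W \<omega> = (if \<omega> \<in> A then cond Q1 t \<tau>1 \<omega> else cond Q2 t \<tau>2 \<omega>)" for \<omega>
  have W [measurable]: "W \<in> borel_measurable (F t)" unfolding W_def[abs_def] by measurable
  have sub: "subalgebra (seq_space X) (F t)"
    by (simp add: subalgebra_def space_coord_filt sets_coord_filt_subset)
  \<comment> \<open>\<open>w\<close> and the indicators are \<open>F t\<close>-measurable, so they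
    can be the multiplier in \<open>nn_integral_cond\<close> under \<open>Q1\<close> and
    \<open>Q2\<close> separately; the two stopped values then recombine into the one at
    \<open>\<tau>3\<close>.\<close>
  have W_int: "(\<integral>\<^sup>+\<omega>\<in>B. W \<omega> \<partial>Q3) = (\<integral>\<^sup>+\<omega>\<in>B. cond Q3 t \<tau>3 \<omega> \<partial>Q3)" if B [measurable]: "B \<in> sets (F t)" for B
  proof -
    have "(\<integral>\<^sup>+\<omega>\<in>B. W \<omega> \<partial>Q3) = (\<integral>\<^sup>+\<omega>. indicator A \<omega> * (W \<omega> * indicator B \<omega>) \<partial>Q1) + (\<integral>\<^sup>+\<omega>. w \<omega> * (W \<omega> * indicator B \<omega>) \<partial>Q2)"
      by (rule int3[rule_format], rule measurable_from_subalg[OF sub]) measurable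
    also have "\<dots> = (\<integral>\<^sup>+\<omega>. (indicator A \<omega> * indicator B \<omega>) * cond Q1 t \<tau>1 \<omega> \<partial>Q1)
        + (\<integral>\<^sup>+\<omega>. (w \<omega> * indicator B \<omega>) * cond Q2 t \<tau>2 \<omega> \<partial>Q2)"
      by (intro arg_cong2[of _ _ _ _ "(+)"] nn_integral_cong) (auto simp: W_def w0 indicator_def)
    also have "\<dots> = (\<integral>\<^sup>+\<omega>. (indicator A \<omega> * indicator B \<omega>) * E (\<tau>1 \<omega>) \<omega> \<partial>Q1)
        + (\<integral>\<^sup>+\<omega>. (w \<omega> * indicator B \<omega>) * E (\<tau>2 \<omega>) \<omega> \<partial>Q2)"
      by (intro arg_cong2[of _ _ _ _ "(+)"] nn_integral_cond Q1 Q2 \<tau>1 \<tau>2) measurable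
    also have "\<dots> = (\<integral>\<^sup>+\<omega>. indicator A \<omega> * (E (\<tau>3 \<omega>) \<omega> * indicator B \<omega>) \<partial>Q1) + (\<integral>\<^sup>+\<omega>. w \<omega> * (E (\<tau>3 \<omega>) \<omega> * indicator B \<omega>) \<partial>Q2)"
      by (intro arg_cong2[of _ _ _ _ "(+)"] nn_integral_cong) (auto simp: \<tau>3_def w0 indicator_def)
    also have "\<dots> = (\<integral>\<^sup>+\<omega>\<in>B. E (\<tau>3 \<omega>) \<omega> \<partial>Q3)"
    proof (rule int3[rule_format, symmetric])
      have "B \<in> sets (seq_space X)" using B sets_coord_filt_subset[of X t] by auto
      then show "(\<lambda>\<omega>. E (\<tau>3 \<omega>) \<omega> * indicator B \<omega>) \<in> borel_measurable (seq_space X)"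
        using borel_measurable_stopped_E[OF \<tau>3] by measurable
    qed
    also have "\<dots> = (\<integral>\<^sup>+\<omega>\<in>B. cond Q3 t \<tau>3 \<omega> \<partial>Q3)" by (rule set_nn_integral_cond[OF Q3Q \<tau>3 B, symmetric])
    finally show ?thesis .
  qed
  have "AE \<omega> in Q3. W \<omega> \<le> cond Q3 t \<tau>3 \<omega>"
    by (rule AE_le_from_set_nn_integral[OF Q3.subalg W borel_measurable_loc_cond_exp])
       (use nn_integral_cond_le_1[OF Q3Q \<tau>3] in \<open>auto simp: W_int intro: le_less_trans\<close>)
  then have "AE \<omega> in Q1. W \<omega> \<le> cond Q3 t \<tau>3 \<omega>"
    by (rule agree_upto_AE[OF agree dom_law_Q[OF Q1] Q3(1), THEN iffD2, rotated]) measurable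
  then have "AE \<omega> in Q1. max (cond Q1 t \<tau>1 \<omega>) (cond Q2 t \<tau>2 \<omega>) \<le> cond Q3 t \<tau>3 \<omega>"
    using AE_space
    by eventually_elim
       (use space_law[OF law_Q[OF Q1]] in \<open>auto simp: W_def A_def space_coord_filt split: if_splits\<close>)
  with Q3Q \<tau>3 agree show ?thesis by blast
qed

text \<open>Induction, forking the current law at \<open>t\<close> once more each time. Agreement
  with \<open>Q0\<close> persists, and it carries each new bound, an \<open>F t\<close>-measurable
  event, back to \<open>Q0\<close>.\<close>

lemma cond_directed_seq:
  assumes Q0: "Q0 \<in> \<Q>" and Qs: "\<And>n :: nat. Qs n \<in> \<Q>" and \<tau>s: "\<And>n. admissible t (\<tau>s n)"
  shows "\<exists>Q\<in>\<Q>. \<exists>\<tau>. admissible t \<tau> \<and> agree_upto t Q0 Q \<and>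
    (AE \<omega> in Q0. \<forall>k\<le>n. cond (Qs k) t (\<tau>s k) \<omega> \<le> cond Q t \<tau> \<omega>)"
proof (induction n)
  case 0
  obtain Q \<tau> where "Q \<in> \<Q>" "admissible t \<tau>" "agree_upto t Q0 Q"
    "AE \<omega> in Q0. max (cond Q0 t (\<lambda>_. t) \<omega>) (cond (Qs 0) t (\<tau>s 0) \<omega>) \<le> cond Q t \<tau> \<omega>"
    using cond_directed[OF Q0 admissible_const Qs[of 0] \<tau>s[of 0]] by blast
  then show ?case by (intro bexI[of _ Q] exI[of _ \<tau>]) auto
next
  case (Suc n)
  then obtain Q \<tau> where Q: "Q \<in> \<Q>" "admissible t \<tau>" "agree_upto t Q0 Q"
    and ae: "AE \<omega> in Q0. \<forall>k\<le>n. cond (Qs k) t (\<tau>s k) \<omega> \<le> cond Q t \<tau> \<omega>" by blast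
  obtain Q' \<tau>' where Q': "Q' \<in> \<Q>" "admissible t \<tau>'" "agree_upto t Q Q'"
    and ae': "AE \<omega> in Q. max (cond Q t \<tau> \<omega>) (cond (Qs (Suc n)) t (\<tau>s (Suc n)) \<omega>) \<le> cond Q' t \<tau>' \<omega>"
    using cond_directed[OF Q(1,2) Qs[of "Suc n"] \<tau>s[of "Suc n"]] by blast
  note [measurable] = borel_measurable_loc_cond_exp
  have "AE \<omega> in Q0. max (cond Q t \<tau> \<omega>) (cond (Qs (Suc n)) t (\<tau>s (Suc n)) \<omega>) \<le> cond Q' t \<tau>' \<omega>"
    using ae' by (rule agree_upto_AE[OF Q(3) dom_law_Q[OF Q0] dom_law_Q[OF Q(1)], THEN iffD2, rotated]) measurable
  with ae have "AE \<omega> in Q0. \<forall>k\<le>Suc n. cond (Qs k) t (\<tau>s k) \<omega> \<le> cond Q' t \<tau>' \<omega>"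
    by eventually_elim (auto simp: le_Suc_eq)
  moreover have "agree_upto t Q0 Q'" using Q(3) Q'(3) by (simp add: agree_upto_def)
  ultimately show ?case using Q' by blast
qed

section \<open>Existence of an adapted version\<close>

lemma cond_family_measurable: "cond_family t \<subseteq> borel_measurable (F t)"
  by (auto simp: cond_family_def borel_measurable_loc_cond_exp)

lemma cond_family_sequence:
  assumes "\<Q> \<noteq> {}"
  shows "\<exists>c :: nat \<Rightarrow> (nat \<Rightarrow> 'a) \<Rightarrow> ennreal. range c \<subseteq> cond_family t \<and>
    (\<forall>f\<in>cond_family t. AE \<omega> in R. f \<omega> \<le> (SUP n. c n \<omega>))"
proof (rule ess_sup_attained_by_sequence)
  show "cond_family t \<subseteq> borel_measurable R" using cond_family_measurable measurable_F by blast
  show "cond_family t \<noteq> {}" using assms admissible_const by (auto simp: cond_family_def)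
qed

lemma snell_envelope_iff:
  "is_snell_envelope X R \<Q> E L \<longleftrightarrow> adapted_proc X L \<and> (\<forall>t. is_ess_sup R (cond_family t) (L t))"
  unfolding is_snell_envelope_def cond_family_def admissible_def by simp

lemma snell_envelope_exists: "\<exists>L. is_snell_envelope X R \<Q> E L"
proof (cases "\<Q> = {}")
  \<comment> \<open>Without laws the family is empty, and the least nonnegative upper bound is
    0.\<close>
  case True
  have "is_snell_envelope X R \<Q> E (\<lambda>_ _. 0)"
    unfolding snell_envelope_iff cond_family_def using True by (simp add: is_ess_sup_def adapted_proc_def)
  then show ?thesis by (intro exI[of _ "\<lambda>_ _. 0"])
next
  case False
  have "\<exists>l. l \<in> borel_measurable (F t) \<and> is_ess_sup R (cond_family t) l" for t
  proof -
    obtain c :: "nat \<Rightarrow> (nat \<Rightarrow> 'a) \<Rightarrow> ennreal" where c: "range c \<subseteq> cond_family t"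
      and ub: "\<forall>f\<in>cond_family t. AE \<omega> in R. f \<omega> \<le> (SUP n. c n \<omega>)"
      using cond_family_sequence[OF False] by metis
    have [measurable]: "c n \<in> borel_measurable (F t)" for n
      using c cond_family_measurable[of t] by auto
    have m: "(\<lambda>\<omega>. SUP n. c n \<omega>) \<in> borel_measurable (F t)" by measurable
    have "AE \<omega> in R. (SUP n. c n \<omega>) \<le> Y' \<omega>" if "\<forall>f\<in>cond_family t. AE \<omega> in R. f \<omega> \<le> Y' \<omega>" for Y'
    proof -
      have "AE \<omega> in R. \<forall>n. c n \<omega> \<le> Y' \<omega>" using that c by (auto simp: AE_all_countable)
      then show ?thesis by eventually_elim (auto intro: SUP_least)
    qed
    with m measurable_F[OF m] ub show ?thesis
      by (intro exI[of _ "\<lambda>\<omega>. SUP n. c n \<omega>"]) (simp add: is_ess_sup_def)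
  qed
  then have "\<forall>t. \<exists>l. l \<in> borel_measurable (F t) \<and> is_ess_sup R (cond_family t) l" by blast
  then obtain L where "\<forall>t. L t \<in> borel_measurable (F t) \<and> is_ess_sup R (cond_family t) (L t)" by metis
  then have "is_snell_envelope X R \<Q> E L" by (simp add: snell_envelope_iff adapted_proc_def)
  then show ?thesis by (intro exI[of _ L])
qed

section \<open>Properties of an arbitrary version of the envelope\<close>

context
  fixes L assumes snell: "is_snell_envelope X R \<Q> E L"
begin

lemma borel_measurable_snell: "L t \<in> borel_measurable (F t)"
  using snell by (simp add: snell_envelope_iff adapted_proc_def)

lemma cond_le_snell:
  assumes "Q \<in> \<Q>" "admissible t \<tau>" shows "AE \<omega> in R. cond Q t \<tau> \<omega> \<le> L t \<omega>"
proof -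
  have "cond Q t \<tau> \<in> cond_family t" using assms by (auto simp: cond_family_def)
  then show ?thesis using snell by (simp add: snell_envelope_iff is_ess_sup_def)
qed

lemma snell_least:
  assumes "f \<in> borel_measurable R" "\<And>Q \<tau>. Q \<in> \<Q> \<Longrightarrow> admissible t \<tau> \<Longrightarrow> AE \<omega> in R. cond Q t \<tau> \<omega> \<le> f \<omega>"
  shows "AE \<omega> in R. L t \<omega> \<le> f \<omega>"
proof -
  have "\<forall>g\<in>cond_family t. AE \<omega> in R. g \<omega> \<le> f \<omega>" using assms(2) by (auto simp: cond_family_def)
  then show ?thesis using assms(1) snell by (simp add: snell_envelope_iff is_ess_sup_def)
qed

lemma cond_le_snell_Q:
  assumes Q: "Q \<in> \<Q>" and \<tau>: "admissible t \<tau>" shows "AE \<omega> in Q. cond Q t \<tau> \<omega> \<le> L t \<omega>"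
proof -
  note [measurable] = borel_measurable_loc_cond_exp borel_measurable_snell[of t]
  have "AE \<omega> in R. 0 < Z Q t \<omega> \<longrightarrow> cond Q t \<tau> \<omega> \<le> L t \<omega>"
    using cond_le_snell[OF Q \<tau>] by eventually_elim simp
  then show ?thesis by (rule AE_law_iff[OF dom_law_Q[OF Q], THEN iffD2, rotated]) measurable
qed

text \<open>Every conditional expectation at time 0 is constant, hence equal to its mean, which
  safety bounds by 1. As \<open>L 0\<close> is constant too, the almost sure bound holds
  everywhere.\<close>

lemma snell_0_le_1: "\<omega> \<in> space (seq_space X) \<Longrightarrow> L 0 \<omega> \<le> 1"
proof -
  have "cond Q 0 \<tau> \<omega> \<le> 1" if Q: "Q \<in> \<Q>" and \<tau>: "admissible 0 \<tau>" and \<omega>: "\<omega> \<in> space (seq_space X)" for Q \<tau> \<omega>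
  proof -
    interpret Q: prob_filtration Q F by (rule prob_filtration_Q[OF Q])
    have "(\<integral>\<^sup>+\<omega>'. cond Q 0 \<tau> \<omega>' \<partial>Q) = (\<integral>\<^sup>+\<omega>'. cond Q 0 \<tau> \<omega> \<partial>Q)"
      by (rule nn_integral_cong, rule measurable_coord_filt_0_const[OF borel_measurable_loc_cond_exp])
         (use space_law[OF law_Q[OF Q]] \<omega> in auto)
    then show ?thesis using nn_integral_cond_le_1[OF Q \<tau>] by (simp add: Q.emeasure_space_1)
  qed
  then have ae: "AE \<omega> in R. L 0 \<omega> \<le> 1"
    by (intro snell_least) (auto intro!: AE_I2 simp: space_law[OF law_R])
  assume "\<omega> \<in> space (seq_space X)"
  then have "L 0 \<omega>' = L 0 \<omega>" if "\<omega>' \<in> space R" for \<omega>'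
    using that by (intro measurable_coord_filt_0_const[OF borel_measurable_snell]) (simp_all add: space_law[OF law_R])
  then have "(AE \<omega>' in R. L 0 \<omega>' \<le> 1) \<longleftrightarrow> (AE \<omega>' in R. L 0 \<omega> \<le> 1)"
    by (intro AE_cong) simp
  with ae show ?thesis by simp
qed

lemma set_supermartingale_snell:
  assumes Q0: "Q0 \<in> \<Q>" shows "prob_filtration.set_supermartingale Q0 F L"
proof -
  interpret Q0: prob_filtration Q0 F by (rule prob_filtration_Q[OF Q0])
  show ?thesis
    unfolding Q0.set_supermartingale_def
  proof (intro conjI allI ballI impI borel_measurable_snell)
    fix s t B assume B: "B \<in> sets (F s)" and st: "s \<le> (t :: nat)"
    have Bt [measurable]: "B \<in> sets (F t)" using B sets_F_mono[OF st] by auto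
    note [measurable] = borel_measurable_snell[of t]
    have ne: "\<Q> \<noteq> {}" using Q0 by auto
    obtain c :: "nat \<Rightarrow> (nat \<Rightarrow> 'a) \<Rightarrow> ennreal" where c: "range c \<subseteq> cond_family t"
      and ub: "\<forall>f\<in>cond_family t. AE \<omega> in R. f \<omega> \<le> (SUP n. c n \<omega>)"
      using cond_family_sequence[OF ne] by metis
    have "\<exists>Q \<tau>. Q \<in> \<Q> \<and> admissible t \<tau> \<and> c n = cond Q t \<tau>" for n
      using subsetD[OF c rangeI, of n] unfolding cond_family_def by (elim CollectE exE conjE) (intro exI conjI)
    then obtain Qs \<tau>s where "\<forall>n. Qs n \<in> \<Q> \<and> admissible t (\<tau>s n) \<and> c n = cond (Qs n) t (\<tau>s n)"
      by metis
    then have Qs: "Qs n \<in> \<Q>" and \<tau>s: "admissible t (\<tau>s n)"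
      and c_eq: "c n = cond (Qs n) t (\<tau>s n)" for n by simp_all
    have cF [measurable]: "c n \<in> borel_measurable (F t)" for n
      using c cond_family_measurable[of t] by auto
    note [measurable] = Q0.measurable_F[OF cF]
    have BQ [measurable]: "B \<in> sets Q0" using B Q0.sets_F by auto
    have "AE \<omega> in R. L t \<omega> \<le> (SUP n. c n \<omega>)"
    proof (rule snell_least)
      show "(\<lambda>\<omega>. SUP n. c n \<omega>) \<in> borel_measurable R" by (intro borel_measurable_SUP measurable_F[OF cF]) simp
      show "AE \<omega> in R. cond Q t \<tau> \<omega> \<le> (SUP n. c n \<omega>)" if "Q \<in> \<Q>" "admissible t \<tau>" for Q \<tau>
        using that by (intro ub[rule_format]) (auto simp: cond_family_def)
    qed
    then have "AE \<omega> in R. 0 < Z Q0 t \<omega> \<longrightarrow> L t \<omega> \<le> (SUP n. c n \<omega>)" by eventually_elim simp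
    then have L_le: "AE \<omega> in Q0. L t \<omega> \<le> (SUP n. c n \<omega>)"
      by (rule AE_law_iff[OF dom_law_Q[OF Q0], THEN iffD2, rotated]) measurable
    \<comment> \<open>Directedness handles finitely many members at a time, so the countable
      supremum is approached through finite maxima.\<close>
    define m where "m n \<omega> = (SUP k\<in>{..n}. c k \<omega>) * indicator B \<omega>" for n \<omega>
    have [measurable]: "m n \<in> borel_measurable Q0" for n unfolding m_def[abs_def] by measurable
    have m_le: "(\<integral>\<^sup>+\<omega>. m n \<omega> \<partial>Q0) \<le> (\<integral>\<^sup>+\<omega>\<in>B. L s \<omega> \<partial>Q0)" for n
    proof -
      obtain Q \<tau> where Q: "Q \<in> \<Q>" and \<tau>: "admissible t \<tau>" and agree: "agree_upto t Q0 Q"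
        and ae: "AE \<omega> in Q0. \<forall>k\<le>n. c k \<omega> \<le> cond Q t \<tau> \<omega>"
        using cond_directed_seq[where Qs = Qs and \<tau>s = \<tau>s, OF Q0 Qs \<tau>s, of n, folded c_eq] by blast
      have \<tau>_s: "admissible s \<tau>" using \<tau> st by (auto simp: admissible_def)
      have [measurable]: "L s \<in> borel_measurable (F t)"
        by (rule measurable_F_mono[OF borel_measurable_snell st])
      note [measurable] = borel_measurable_loc_cond_exp
      have "(\<integral>\<^sup>+\<omega>. m n \<omega> \<partial>Q0) \<le> (\<integral>\<^sup>+\<omega>\<in>B. cond Q t \<tau> \<omega> \<partial>Q0)"
        unfolding m_def
        by (rule nn_integral_mono_AE, use ae in eventually_elim) (auto intro!: mult_right_mono SUP_least)
      also have "\<dots> = (\<integral>\<^sup>+\<omega>\<in>B. cond Q t \<tau> \<omega> \<partial>Q)"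
        using agree unfolding agree_upto_def by (rule bspec) measurable
      \<comment> \<open>Tower property in integrated form: \<open>B\<close> lies in both
        sigma-algebras, so both sides equal the integral over \<open>B\<close> of \<open>E\<close>
        stopped at the same \<open>\<tau>\<close>.\<close>
      also have "\<dots> = (\<integral>\<^sup>+\<omega>\<in>B. cond Q s \<tau> \<omega> \<partial>Q)"
        by (simp add: set_nn_integral_cond[OF Q \<tau> Bt] set_nn_integral_cond[OF Q \<tau>_s B])
      also have "\<dots> \<le> (\<integral>\<^sup>+\<omega>\<in>B. L s \<omega> \<partial>Q)"
        by (rule nn_integral_mono_AE, use cond_le_snell_Q[OF Q \<tau>_s] in eventually_elim)
           (auto intro: mult_right_mono)
      also have "\<dots> = (\<integral>\<^sup>+\<omega>\<in>B. L s \<omega> \<partial>Q0)"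
        by (rule sym, use agree in \<open>unfold agree_upto_def\<close>, erule bspec) measurable
      finally show ?thesis .
    qed
    have "(\<integral>\<^sup>+\<omega>\<in>B. L t \<omega> \<partial>Q0) \<le> (\<integral>\<^sup>+\<omega>. (SUP n. m n \<omega>) \<partial>Q0)"
    proof (rule nn_integral_mono_AE, use L_le in eventually_elim)
      case (elim \<omega>)
      have "c n \<omega> * indicator B \<omega> \<le> (SUP n. m n \<omega>)" for n
        unfolding m_def by (intro SUP_upper2[of n] mult_right_mono SUP_upper) auto
      then have "(SUP n. c n \<omega> * indicator B \<omega>) \<le> (SUP n. m n \<omega>)" by (rule SUP_least)
      moreover have "L t \<omega> * indicator B \<omega> \<le> (SUP n. c n \<omega> * indicator B \<omega>)"
        using elim by (auto simp: indicator_def)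
      ultimately show ?case by simp
    qed
    also have "\<dots> = (SUP n. \<integral>\<^sup>+\<omega>. m n \<omega> \<partial>Q0)"
    proof (rule nn_integral_monotone_convergence_SUP)
      show "incseq m"
        by (auto simp: incseq_def le_fun_def m_def intro!: mult_right_mono SUP_subset_mono)
    qed measurable
    also have "\<dots> \<le> (\<integral>\<^sup>+\<omega>\<in>B. L s \<omega> \<partial>Q0)" by (rule SUP_least) (rule m_le)
    finally show "(\<integral>\<^sup>+\<omega>\<in>B. L t \<omega> \<partial>Q0) \<le> (\<integral>\<^sup>+\<omega>\<in>B. L s \<omega> \<partial>Q0)" .
  qed
qed

lemma nn_integral_snell_0_le_1:
  assumes Q: "Q \<in> \<Q>" shows "(\<integral>\<^sup>+\<omega>. L 0 \<omega> \<partial>Q) \<le> 1"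
proof -
  interpret Q: prob_filtration Q F by (rule prob_filtration_Q[OF Q])
  have "(\<integral>\<^sup>+\<omega>. L 0 \<omega> \<partial>Q) \<le> (\<integral>\<^sup>+\<omega>. 1 \<partial>Q)"
    by (rule nn_integral_mono) (auto intro: snell_0_le_1 simp: space_law[OF law_Q[OF Q]])
  then show ?thesis by (simp add: Q.emeasure_space_1)
qed

lemma nsm_snell: "nsm X \<Q> L"
proof -
  have "(\<integral>\<^sup>+\<omega>. L t \<omega> \<partial>Q) < \<infinity> \<and> (\<forall>s t. s \<le> t \<longrightarrow> (AE \<omega> in Q. nn_cond_exp Q (F s) (L t) \<omega> \<le> L s \<omega>))"
    if Q: "Q \<in> \<Q>" for Q t
  proof -
    interpret Q: prob_filtration Q F by (rule prob_filtration_Q[OF Q])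
    note sm = set_supermartingale_snell[OF Q]
    \<comment> \<open>Comparison with time 0 on the whole space gives the integrability needed to
      leave the integrated form.\<close>
    have fin: "(\<integral>\<^sup>+\<omega>. L t \<omega> \<partial>Q) < \<infinity>" for t
    proof -
      have "(\<integral>\<^sup>+\<omega>\<in>space (F 0). L t \<omega> \<partial>Q) \<le> (\<integral>\<^sup>+\<omega>\<in>space (F 0). L 0 \<omega> \<partial>Q)"
        using sm unfolding Q.set_supermartingale_def by blast
      then have "(\<integral>\<^sup>+\<omega>. L t \<omega> \<partial>Q) \<le> (\<integral>\<^sup>+\<omega>. L 0 \<omega> \<partial>Q)"
        by (simp add: Q.space_F cong: nn_integral_cong)
      also note nn_integral_snell_0_le_1[OF Q]
      finally show ?thesis by (rule le_less_trans) simp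
    qed
    with sm Q.set_supermartingale_iff[of L] borel_measurable_snell show ?thesis by blast
  qed
  then show ?thesis using borel_measurable_snell by (auto simp: nsm_def adapted_proc_def)
qed

text \<open>The constant time \<open>t\<close> is admissible, and its conditional expectation has
  the same integrals as \<open>E t\<close> over \<open>F t\<close>-measurable sets.\<close>

lemma snell_dominates: "dominates \<Q> L E"
  unfolding dominates_def
proof (intro ballI allI)
  fix Q t assume Q: "Q \<in> \<Q>"
  interpret Q: prob_filtration Q F by (rule prob_filtration_Q[OF Q])
  have "AE \<omega> in Q. E t \<omega> \<le> cond Q t (\<lambda>_. t) \<omega>"
  proof (rule AE_le_from_set_nn_integral[OF Q.subalg _ borel_measurable_loc_cond_exp])
    show "E t \<in> borel_measurable (F t)" using adapted_E by (simp add: adapted_proc_def)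
    show "(\<integral>\<^sup>+\<omega>. cond Q t (\<lambda>_. t) \<omega> \<partial>Q) < \<infinity>"
      by (rule le_less_trans[OF nn_integral_cond_le_1[OF Q admissible_const]]) simp
  qed (simp add: set_nn_integral_cond[OF Q admissible_const])
  with cond_le_snell_Q[OF Q admissible_const] show "AE \<omega> in Q. E t \<omega> \<le> L t \<omega>"
    by eventually_elim (rule order_trans)
qed

lemma cond_le_dominating_nsm:
  assumes L': "nsm X \<Q> L'" "dominates \<Q> L' E" and Q: "Q \<in> \<Q>" and \<tau>: "admissible t \<tau>"
  shows "AE \<omega> in Q. cond Q t \<tau> \<omega> \<le> L' t \<omega>"
proof -
  interpret Q: prob_filtration Q F by (rule prob_filtration_Q[OF Q])
  have L'F: "L' t \<in> borel_measurable (F t)" and fin: "(\<integral>\<^sup>+\<omega>. L' t \<omega> \<partial>Q) < \<infinity>" for t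
    using L' Q by (auto simp: nsm_def adapted_proc_def)
  have sm: "Q.set_supermartingale L'"
    using L'(1) Q by (subst Q.set_supermartingale_iff[OF L'F fin]) (auto simp: nsm_def)
  show ?thesis
  proof (rule AE_le_from_set_nn_integral[OF Q.subalg borel_measurable_loc_cond_exp L'F fin])
    fix B assume B: "B \<in> sets (F t)"
    have ae: "AE \<omega> in Q. \<forall>k. E k \<omega> \<le> L' k \<omega>"
      using L'(2) Q by (auto simp: dominates_def AE_all_countable)
    have "(\<integral>\<^sup>+\<omega>\<in>B. E (\<tau> \<omega>) \<omega> \<partial>Q) \<le> (\<integral>\<^sup>+\<omega>\<in>B. L' (\<tau> \<omega>) \<omega> \<partial>Q)"
      by (rule nn_integral_mono_AE, use ae in eventually_elim) (auto intro: mult_right_mono)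
    also have "\<dots> \<le> (\<integral>\<^sup>+\<omega>\<in>B. L' t \<omega> \<partial>Q)"
      using Q.supermartingale_optional_stopping[OF sm, of "\<lambda>\<omega>. enat (\<tau> \<omega>)" t B] \<tau> B space_law[OF law_Q[OF Q]]
      by (simp add: admissible_def stopping_time_def)
    finally show "(\<integral>\<^sup>+\<omega>\<in>B. cond Q t \<tau> \<omega> \<partial>Q) \<le> (\<integral>\<^sup>+\<omega>\<in>B. L' t \<omega> \<partial>Q)"
      by (simp add: set_nn_integral_cond[OF Q \<tau> B])
  qed
qed

text \<open>The conditional expectation under \<open>Q\<close> has to be bounded
  \<open>Q0\<close>-almost surely, but optional stopping under \<open>Q\<close> says nothing there.
  It is first dominated by one under a fork \<open>Q3\<close> of \<open>Q0\<close>, where optional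
  stopping does give a bound valid under \<open>Q0\<close>.\<close>

lemma snell_smallest:
  assumes L': "nsm X \<Q> L'" "dominates \<Q> L' E" shows "dominates \<Q> L' L"
  unfolding dominates_def
proof (intro ballI allI)
  fix Q0 t assume Q0: "Q0 \<in> \<Q>"
  note [measurable] = borel_measurable_loc_cond_exp borel_measurable_snell[of t] borel_measurable_lik_ratio[of Q0 t]
  have [measurable]: "L' t \<in> borel_measurable (F t)" using L' by (simp add: nsm_def adapted_proc_def)
  \<comment> \<open>The value infinity where \<open>Z Q0 t\<close> vanishes turns a bound known
    under \<open>Q0\<close> into an upper bound holding \<open>R\<close>-almost surely, as
    \<open>snell_least\<close> requires.\<close>
  define f where "f \<omega> = (if 0 < Z Q0 t \<omega> then L' t \<omega> else \<infinity>)" for \<omega>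
  have "f \<in> borel_measurable (F t)" unfolding f_def[abs_def] by measurable
  then have "f \<in> borel_measurable R" by (rule measurable_F)
  then have "AE \<omega> in R. L t \<omega> \<le> f \<omega>"
  proof (rule snell_least)
    fix Q \<tau> assume Q: "Q \<in> \<Q>" and \<tau>: "admissible t \<tau>"
    obtain Q3 \<tau>3 where Q3: "Q3 \<in> \<Q>" "admissible t \<tau>3" "agree_upto t Q0 Q3"
      and ae: "AE \<omega> in Q0. max (cond Q0 t (\<lambda>_. t) \<omega>) (cond Q t \<tau> \<omega>) \<le> cond Q3 t \<tau>3 \<omega>"
      using cond_directed[OF Q0 admissible_const Q \<tau>] by blast
    have "AE \<omega> in Q0. cond Q3 t \<tau>3 \<omega> \<le> L' t \<omega>"
      using cond_le_dominating_nsm[OF L' Q3(1,2)]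
      by (rule agree_upto_AE[OF Q3(3) dom_law_Q[OF Q0] dom_law_Q[OF Q3(1)], THEN iffD2, rotated]) measurable
    with ae have "AE \<omega> in Q0. cond Q t \<tau> \<omega> \<le> L' t \<omega>" by eventually_elim auto
    then have "AE \<omega> in R. 0 < Z Q0 t \<omega> \<longrightarrow> cond Q t \<tau> \<omega> \<le> L' t \<omega>"
      by (rule AE_law_iff[OF dom_law_Q[OF Q0], THEN iffD1, rotated]) measurable
    then show "AE \<omega> in R. cond Q t \<tau> \<omega> \<le> f \<omega>" by eventually_elim (simp add: f_def)
  qed
  then have "AE \<omega> in R. 0 < Z Q0 t \<omega> \<longrightarrow> L t \<omega> \<le> L' t \<omega>"
    by eventually_elim (auto simp: f_def)
  then show "AE \<omega> in Q0. L t \<omega> \<le> L' t \<omega>"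
    by (rule AE_law_iff[OF dom_law_Q[OF Q0], THEN iffD2, rotated]) measurable
qed

lemma safe_snell: "safe_e_process X \<Q> L"
  unfolding safe_e_process_def
proof (intro conjI SUP_least)
  show "adapted_proc X L" by (simp add: adapted_proc_def borel_measurable_snell)
  fix Q \<tau> assume Q: "Q \<in> \<Q>" and "\<tau> \<in> {\<tau>. ext_stopping_time X \<tau>}"
  then have \<tau>: "Measurable.pred (F t) (\<lambda>\<omega>. \<tau> \<omega> \<le> enat t)" for t by (simp add: ext_stopping_time_def)
  interpret Q: prob_filtration Q F by (rule prob_filtration_Q[OF Q])
  note sm = set_supermartingale_snell[OF Q]
  \<comment> \<open>Almost sure convergence replaces the \<open>limsup\<close> at infinity by the
    \<open>liminf\<close> of optional stopping, used from time 0 with the whole space as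
    \<open>B\<close>.\<close>
  have "(\<integral>\<^sup>+\<omega>. ext_stopped L \<tau> \<omega> \<partial>Q)
      = (\<integral>\<^sup>+\<omega>\<in>space (F 0). (case \<tau> \<omega> of enat k \<Rightarrow> L k \<omega> | \<infinity> \<Rightarrow> liminf (\<lambda>t. L t \<omega>)) \<partial>Q)"
    by (rule nn_integral_cong_AE, use Q.supermartingale_AE_liminf_eq_limsup[OF sm] AE_space in eventually_elim)
       (auto simp: ext_stopped_def Q.space_F split: enat.split)
  also have "\<dots> \<le> (\<integral>\<^sup>+\<omega>\<in>space (F 0). L 0 \<omega> \<partial>Q)"
    by (rule Q.supermartingale_optional_stopping[OF sm \<tau>]) (simp_all add: zero_enat_def[symmetric])
  also have "\<dots> = (\<integral>\<^sup>+\<omega>. L 0 \<omega> \<partial>Q)"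
    by (rule nn_integral_cong) (simp add: Q.space_F)
  also have "\<dots> \<le> 1" by (rule nn_integral_snell_0_le_1[OF Q])
  finally show "(\<integral>\<^sup>+\<omega>. ext_stopped L \<tau> \<omega> \<partial>Q) \<le> 1" .
qed

end

end

theorem theorem14:
  fixes X :: "'a measure"
    and R :: "(nat \<Rightarrow> 'a) measure"
    and \<Q> :: "(nat \<Rightarrow> 'a) measure set"
    and E :: "nat \<Rightarrow> (nat \<Rightarrow> 'a) \<Rightarrow> ennreal"
  assumes "law X R"
    and "\<And>Q. Q \<in> \<Q> \<Longrightarrow> law X Q"
    and "\<And>Q. Q \<in> \<Q> \<Longrightarrow> locally_dominated X R Q"
    and "fork_convex X R \<Q>"
    and "safe_e_process X \<Q> E"
  shows "(\<exists>L. is_snell_envelope X R \<Q> E L) \<and>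
    (\<forall>L. is_snell_envelope X R \<Q> E L \<longrightarrow>
       smallest_dominating_nsm X \<Q> E L \<and>
       (\<forall>\<omega> \<in> space (seq_space X). L 0 \<omega> \<le> 1) \<and>
       safe_e_process X \<Q> L)"
proof -
  interpret safe_setting X R \<Q> E by unfold_locales (fact assms)+
  show ?thesis
    using snell_envelope_exists nsm_snell snell_dominates snell_smallest snell_0_le_1 safe_snell
    by (auto simp: smallest_dominating_nsm_def)
qed

end
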